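(* Let $(P,c)$ be a linear program, i.e. $P\subset\mathbb{R}^d$ a polytope and $c\in\mathbb{R}^d$ a generic objective function, and let $\eta$ be a normalization. Then the pivot rule polytope $\Pi^\eta_{P,c}$ is a weak Minkowski summand of the sweep polytope of normalized $c$-improving edge directions $\mathrm{SP}(\mathrm{ED}^\eta(P,c))$. Furthermore, the neighbotope $\Gamma^\eta_P$ is a weak Minkowski summand of the sweep polytope of normalized edge directions $\mathrm{SP}(\mathrm{ED}^\eta(P))$.
   Context: For a polytope $P\subset\mathbb{R}^d$, $V(P)$ denotes its vertex set, $E(P)$ its edges, $G(P)$ its graph, $\mathrm{Nb}_P(v)$ the set of vertices adjacent to $v$. $c\in\mathbb{R}^d$ is generic for $P$ if $c^tu\ne c^tv$ for all edges $uv$; $v_{opt}$ is then the unique maximizing vertex. A normalization is a function $\eta:\mathbb{R}^d\to\mathbb{R}$ (such that the quotients below are defined), with the convention $\frac{0}{\eta(0)}=0$. A $c$-arborescence is a map $\mathcal{A}:V(P)\to V(P)$ with $\mathcal{A}(v_{opt})=v_{opt}$ and, for $v\neq v_{opt}$, $\mathcal{A}(v)\in\mathrm{Nb}_P(v)$ with $c^t\mathcal{A}(v)>c^tv$. An arborescence on $G(P)$ is a map $\mathcal{B}:V(P)\to V(P)$ with a unique fixed point $r$, $\mathcal{B}(v)\in\mathrm{Nb}_P(v)$ for $v\neq r$, and such that for every $v$ there is $k\ge 1$ with $\mathcal{B}^k(v)=r$. For any such map $f$ put $\psi^\eta(f)=\sum_{v\in V(P)}\frac{f(v)-v}{\eta(f(v)-v)}$.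 Then $\Pi^\eta_{P,c}=\operatorname{conv}\{\psi^\eta(\mathcal{A}):\mathcal{A}\text{ a }c\text{-arborescence of }(P,c)\}$ and $\Gamma^\eta_P=\operatorname{conv}\{\psi^\eta(\mathcal{B}):\mathcal{B}\text{ an arborescence of }G(P)\}$. $\mathrm{ED}^\eta(P)=\{\frac{u-v}{\eta(u-v)} : uv\in E(P)\}$, where both orderings $(u,v)$ and $(v,u)$ of each edge are used, and $\mathrm{ED}^\eta(P,c)=\{\frac{u-v}{\eta(u-v)} : uv\in E(P),\ c^tu>c^tv\}$. For points $p_1,\dots,p_n\in\mathbb{R}^d$, the sweep polytope is the Minkowski sum $\mathrm{SP}(p_1,\dots,p_n)=\sum_{i<j}[p_i-p_j,p_j-p_i]$. A polytope $Q\subset\mathbb{R}^d$ is a weak Minkowski summand of a polytope $P\subset\mathbb{R}^d$ if $\lambda P=Q+R$ for some $\lambda>0$ and some polytope $R\subset\mathbb{R}^d$.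
   Formalization: The neighbotope claim fails for arbitrary normalizations (there is a counterexample on a triangle); it is stated for η that is positive on all edge directions, negative on all of them, or odd on them. P is taken nonempty. *)

theory Defs
  imports "HOL-Analysis.Analysis" "HOL-Library.Set_Algebras"
begin

definition vertices :: "'a::euclidean_space set \<Rightarrow> 'a set" where
  "vertices P = {v. v extreme_point_of P}"

text \<open>If the segment between \<open>u\<close> and \<open>v\<close> is a one-dimensional face of \<open>P\<close>, then \<open>u\<close> and \<open>v\<close>
  are distinct vertices of \<open>P\<close>.\<close>

definition Nb :: "'a::euclidean_space set \<Rightarrow> 'a \<Rightarrow> 'a set" where
  "Nb P v = {u. closed_segment u v edge_of P}"

definition generic :: "'a::euclidean_space set \<Rightarrow> 'a \<Rightarrow> bool" where
  "generic P c \<longleftrightarrow> (\<forall>v u. u \<in> Nb P v \<longrightarrow> c \<bullet> u \<noteq> c \<bullet> v)"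

definition v_opt :: "'a::euclidean_space set \<Rightarrow> 'a \<Rightarrow> 'a" where
  "v_opt P c = (THE v. v \<in> vertices P \<and> (\<forall>u \<in> vertices P. c \<bullet> u \<le> c \<bullet> v))"

text \<open>The quotients that have to be defined are those along edge directions, for both
  orientations of each edge.\<close>

definition normalization :: "'a::euclidean_space set \<Rightarrow> ('a \<Rightarrow> real) \<Rightarrow> bool" where
  "normalization P \<eta> \<longleftrightarrow> (\<forall>v u. u \<in> Nb P v \<longrightarrow> \<eta> (u - v) \<noteq> 0)"

definition c_arborescence :: "'a::euclidean_space set \<Rightarrow> 'a \<Rightarrow> ('a \<Rightarrow> 'a) \<Rightarrow> bool" where
  "c_arborescence P c \<A> \<longleftrightarrow>
     \<A> \<in> vertices P \<rightarrow> vertices P \<and>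
     \<A> (v_opt P c) = v_opt P c \<and>
     (\<forall>v \<in> vertices P. v \<noteq> v_opt P c \<longrightarrow> \<A> v \<in> Nb P v \<and> c \<bullet> \<A> v > c \<bullet> v)"

definition arborescence :: "'a::euclidean_space set \<Rightarrow> ('a \<Rightarrow> 'a) \<Rightarrow> bool" where
  "arborescence P \<B> \<longleftrightarrow>
     \<B> \<in> vertices P \<rightarrow> vertices P \<and>
     (\<exists>r. {v \<in> vertices P. \<B> v = v} = {r} \<and>
          (\<forall>v \<in> vertices P. v \<noteq> r \<longrightarrow> \<B> v \<in> Nb P v) \<and>
          (\<forall>v \<in> vertices P. \<exists>k\<ge>1. (\<B> ^^ k) v = r))"

text \<open>Here \<open>x /\<^sub>R r\<close> is the scaled vector \<open>(1/r) x\<close>. A fixed point of \<open>f\<close> contributes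
  \<open>0\<close> whatever the value \<open>\<eta> 0\<close> is, as in the convention \<open>0 / \<eta>(0) = 0\<close>.\<close>

definition psi :: "('a::euclidean_space \<Rightarrow> real) \<Rightarrow> 'a set \<Rightarrow> ('a \<Rightarrow> 'a) \<Rightarrow> 'a" where
  "psi \<eta> P f = (\<Sum>v \<in> vertices P. (f v - v) /\<^sub>R \<eta> (f v - v))"

definition pivot_rule_polytope ::
  "('a::euclidean_space \<Rightarrow> real) \<Rightarrow> 'a set \<Rightarrow> 'a \<Rightarrow> 'a set" where
  "pivot_rule_polytope \<eta> P c = convex hull {psi \<eta> P \<A> |\<A>. c_arborescence P c \<A>}"

text \<open>For the neighbotope the signs of \<open>\<eta>\<close> matter. Take the triangle with vertices \<open>a = (0,0)\<close>,
  \<open>b = (1,0)\<close>, \<open>c = (0,1)\<close> and let \<open>1/\<eta>(b-a) = 3\<close>, \<open>1/\<eta>(a-b) = -1\<close>, \<open>1/\<eta>(c-b) = -3\<close>,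
  \<open>1/\<eta>(b-c) = -10\<close>, \<open>1/\<eta>(a-c) = 10\<close>, \<open>1/\<eta>(c-a) = 3\<close>. The functional \<open>w = (2,5/3)\<close>
  takes six different values on the normalized edge directions, hence has a unique maximizer on
  their sweep polytope, but it is maximized on the neighbotope along the segment from \<open>(6,-3)\<close>
  to \<open>(1,3)\<close>, so the neighbotope is not a weak Minkowski summand. This does not happen when \<open>\<eta>\<close>
  has constant sign on the edge directions (such as a norm or a constant), nor when it is odd on
  them (such as a linear functional).\<close>

definition neighbotope :: "('a::euclidean_space \<Rightarrow> real) \<Rightarrow> 'a set \<Rightarrow> 'a set" where
  "neighbotope \<eta> P = convex hull {psi \<eta> P \<B> |\<B>. arborescence P \<B>}"

definition ED :: "('a::euclidean_space \<Rightarrow> real) \<Rightarrow> 'a set \<Rightarrow> 'a set" where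
  "ED \<eta> P = {(u - v) /\<^sub>R \<eta> (u - v) |u v. u \<in> Nb P v}"

definition ED_improving :: "('a::euclidean_space \<Rightarrow> real) \<Rightarrow> 'a set \<Rightarrow> 'a \<Rightarrow> 'a set" where
  "ED_improving \<eta> P c = {(u - v) /\<^sub>R \<eta> (u - v) |u v. u \<in> Nb P v \<and> c \<bullet> u > c \<bullet> v}"

definition sweep_polytope :: "'a::euclidean_space list \<Rightarrow> 'a set" where
  "sweep_polytope ps =
     (\<Sum>(i, j) \<in> {(i, j). i < j \<and> j < length ps}. closed_segment (ps ! i - ps ! j) (ps ! j - ps ! i))"

lemma sweep_polytope_cong:
  assumes "distinct ps" "distinct qs" "set ps = set qs"
  shows "sweep_polytope ps = sweep_polytope qs"
proof -
  define h where "h = (\<lambda>e::'a set. convex hull {p - q |p q. p \<in> e \<and> q \<in> e \<and> p \<noteq> q})"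
  have *: "sweep_polytope xs = (\<Sum>e \<in> {e. e \<subseteq> set xs \<and> card e = 2}. h e)"
    if d: "distinct xs" for xs :: "'a list"
  proof -
    let ?I = "{(i, j). i < j \<and> j < length xs}" and ?f = "\<lambda>(i, j). {xs ! i, xs ! j}"
    have inj: "inj_on ?f ?I"
      using d by (auto simp: inj_on_def doubleton_eq_iff nth_eq_iff_index_eq)
    have img: "?f ` ?I = {e. e \<subseteq> set xs \<and> card e = 2}"
    proof (intro equalityI subsetI)
      fix e assume "e \<in> ?f ` ?I"
      then show "e \<in> {e. e \<subseteq> set xs \<and> card e = 2}"
        using d by (auto simp: nth_eq_iff_index_eq card_insert_if)
    next
      fix e assume "e \<in> {e. e \<subseteq> set xs \<and> card e = 2}"
      then obtain p q where e: "e = {p, q}" "p \<noteq> q" "p \<in> set xs" "q \<in> set xs"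
        by (auto simp: card_2_iff)
      then obtain i j where ij: "i < length xs" "xs ! i = p" "j < length xs" "xs ! j = q"
        by (auto simp: in_set_conv_nth)
      with e have "i < j \<or> j < i" by (metis linorder_neqE_nat)
      then show "e \<in> ?f ` ?I"
      proof
        assume "i < j"
        then show ?thesis using e ij by (intro image_eqI[of _ _ "(i, j)"]) auto
      next
        assume "j < i"
        then show ?thesis using e ij by (intro image_eqI[of _ _ "(j, i)"]) auto
      qed
    qed
    have seg: "h {p, q} = closed_segment (p - q) (q - p)" if "p \<noteq> q" for p q
    proof -
      have "{x - y |x y. x \<in> {p, q} \<and> y \<in> {p, q} \<and> x \<noteq> y} = {p - q, q - p}"
        using that by auto
      then show ?thesis by (simp add: h_def segment_convex_hull)
    qed
    have "sum h (?f ` ?I) = sum (h \<circ> ?f) ?I"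
      using inj by (rule sum.reindex)
    also have "\<dots> = sweep_polytope xs"
      unfolding sweep_polytope_def
      by (rule sum.cong) (use d in \<open>auto simp: seg nth_eq_iff_index_eq\<close>)
    finally show ?thesis by (simp add: img)
  qed
  show ?thesis using assms by (simp add: *)
qed

text \<open>For a finite set of points, by the lemma above, the choice of the enumeration is irrelevant.\<close>

definition SP :: "'a::euclidean_space set \<Rightarrow> 'a set" where
  "SP S = sweep_polytope (SOME ps. distinct ps \<and> set ps = S)"

lemma SP_eq:
  assumes "distinct ps" "set ps = S"
  shows "SP S = sweep_polytope ps"
proof -
  have "distinct (SOME ps. distinct ps \<and> set ps = S) \<and> set (SOME ps. distinct ps \<and> set ps = S) = S"
    using assms by (intro someI[of "\<lambda>ps. distinct ps \<and> set ps = S" ps]) simp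
  then show ?thesis
    unfolding SP_def using assms by (intro sweep_polytope_cong) auto
qed

text \<open>The sum of sets is the Minkowski sum from \<^theory>\<open>HOL-Library.Set_Algebras\<close>.\<close>

definition weak_Minkowski_summand :: "'a::euclidean_space set \<Rightarrow> 'a set \<Rightarrow> bool" where
  "weak_Minkowski_summand Q P \<longleftrightarrow>
     polytope Q \<and> polytope P \<and>
     (\<exists>l>0. \<exists>R. polytope R \<and> (\<lambda>x. l *\<^sub>R x) ` P = Q + R)"

end

(* The points p + (p_j - p_i) with i < j, for p the sum of the differences p_i - p_j (i < j), lie in
   the sweep polytope of p_1, ..., p_n, so its tangent cone at p contains the order cone generated
   by the p_j - p_i. Hence conv Q is a weak Minkowski summand as soon as every order of the points
   induced by a generic w admits some q0 in Q with q - q0 in the order cone for all q in Q.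
   For the pivot rule polytope q0 picks at each vertex the first improving direction; every
   non-optimal vertex has one because the cone of a polytope at a vertex is generated by edges. For
   the neighbotope with normalization of constant sign q0 picks the first direction of all edges at
   each vertex but the optimum. For an odd normalization arborescences are oriented spanning trees,
   q0 is the minimum spanning tree of the order, and q - q0 is expanded by Abel summation, using
   that a minimum spanning tree has the most edges below every threshold. *)

theory Submission
  imports Defs
begin

section \<open>Edges at a vertex of a polytope\<close>

text \<open>This is the cone of feasible directions, taken without closure; for polytopes it is the
  usual tangent cone.\<close>

definition tangent_cone :: "'a::real_vector set \<Rightarrow> 'a \<Rightarrow> 'a set" where
  "tangent_cone C p = {z. \<exists>l>0. p + l *\<^sub>R z \<in> C}"

text \<open>By convexity the whole segment from \<open>p\<close> to a feasible point stays in
  \<open>C\<close>, so finitely many directions can be given a common step length.\<close>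

lemma tangent_coneE:
  assumes "convex C" "p \<in> C" "z \<in> tangent_cone C p"
  obtains l where "l > 0" "\<And>t. 0 \<le> t \<Longrightarrow> t \<le> l \<Longrightarrow> p + t *\<^sub>R z \<in> C"
proof -
  from assms(3) obtain l where l: "l > 0" "p + l *\<^sub>R z \<in> C"
    by (auto simp: tangent_cone_def)
  have "p + t *\<^sub>R z \<in> C" if "0 \<le> t" "t \<le> l" for t
  proof -
    have "(1 - t / l) *\<^sub>R p + (t / l) *\<^sub>R (p + l *\<^sub>R z) \<in> C"
      using assms l that by (intro convexD) auto
    also have "(1 - t / l) *\<^sub>R p + (t / l) *\<^sub>R (p + l *\<^sub>R z) = p + t *\<^sub>R z"
      using l by (simp add: algebra_simps)
    finally show ?thesis .
  qed
  with l(1) show thesis by (rule that)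
qed

text \<open>For sums, the midpoint of two feasible points with common step length \<open>t\<close>
  is a feasible point in direction \<open>x + y\<close> with step length \<open>t/2\<close>.\<close>

lemma convex_cone_tangent_cone:
  assumes "convex C" "p \<in> C"
  shows "convex_cone (tangent_cone C p)"
  unfolding convex_cone_iff
proof (intro conjI ballI allI impI)
  show "0 \<in> tangent_cone C p"
    using assms by (auto simp: tangent_cone_def intro!: exI[of _ 1])
next
  fix x y assume "x \<in> tangent_cone C p" "y \<in> tangent_cone C p"
  then obtain k l where k: "k > 0" "\<And>t. 0 \<le> t \<Longrightarrow> t \<le> k \<Longrightarrow> p + t *\<^sub>R x \<in> C"
    and l: "l > 0" "\<And>t. 0 \<le> t \<Longrightarrow> t \<le> l \<Longrightarrow> p + t *\<^sub>R y \<in> C"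
    by (metis assms tangent_coneE)
  define t where "t = min k l"
  have t: "t > 0" "t \<le> k" "t \<le> l" using k l by (auto simp: t_def)
  have "(1/2) *\<^sub>R (p + t *\<^sub>R x) + (1/2) *\<^sub>R (p + t *\<^sub>R y) \<in> C"
    using assms k l t by (intro convexD) auto
  also have "(1/2) *\<^sub>R (p + t *\<^sub>R x) + (1/2) *\<^sub>R (p + t *\<^sub>R y)
      = (1/2) *\<^sub>R p + (1/2) *\<^sub>R p + (t/2) *\<^sub>R (x + y)"
    by (simp add: algebra_simps)
  also have "(1/2) *\<^sub>R p + (1/2) *\<^sub>R p = p"
    by (simp flip: scaleR_add_left)
  finally show "x + y \<in> tangent_cone C p"
    using t by (auto simp: tangent_cone_def intro!: exI[of _ "t/2"])
next
  fix x and r :: real assume x: "x \<in> tangent_cone C p" and r: "0 \<le> r"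
  show "r *\<^sub>R x \<in> tangent_cone C p"
  proof (cases "r = 0")
    case True
    then show ?thesis
      using assms by (auto simp: tangent_cone_def intro!: exI[of _ 1])
  next
    case False
    from x obtain l where "l > 0" "p + l *\<^sub>R x \<in> C"
      by (auto simp: tangent_cone_def)
    then show ?thesis
      using False r by (auto simp: tangent_cone_def intro!: exI[of _ "l / r"])
  qed
qed

text \<open>Otherwise \<open>v\<close> would be the midpoint of a nondegenerate segment in
  \<open>P\<close>.\<close>

lemma tangent_cone_pointed:
  assumes P: "convex P" and v: "v extreme_point_of P"
    and z: "z \<in> tangent_cone P v" "- z \<in> tangent_cone P v"
  shows "z = 0"
proof (rule ccontr)
  assume "z \<noteq> 0"
  have "v \<in> P" using v by (simp add: extreme_point_of_def)
  obtain k l where k: "k > 0" "\<And>t. 0 \<le> t \<Longrightarrow> t \<le> k \<Longrightarrow> v + t *\<^sub>R z \<in> P"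
    and l: "l > 0" "\<And>t. 0 \<le> t \<Longrightarrow> t \<le> l \<Longrightarrow> v + t *\<^sub>R (- z) \<in> P"
    by (metis P \<open>v \<in> P\<close> z tangent_coneE)
  define t where "t = min k l"
  have t: "t > 0" "v + t *\<^sub>R z \<in> P" "v - t *\<^sub>R z \<in> P"
    using k(1) l(1) k(2)[of t] l(2)[of t] by (auto simp: t_def)
  have "v = midpoint (v + t *\<^sub>R z) (v - t *\<^sub>R z)"
    by (simp add: midpoint_def algebra_simps flip: scaleR_add_left)
  moreover have "v + t *\<^sub>R z \<noteq> v - t *\<^sub>R z"
  proof
    assume "v + t *\<^sub>R z = v - t *\<^sub>R z"
    then have "t *\<^sub>R z + t *\<^sub>R z = 0" by (simp add: algebra_simps)
    then have "(t + t) *\<^sub>R z = 0" by (simp only: scaleR_left_distrib)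
    then show False using t \<open>z \<noteq> 0\<close> by simp
  qed
  ultimately have "v \<in> open_segment (v + t *\<^sub>R z) (v - t *\<^sub>R z)"
    by (metis midpoint_in_open_segment)
  then show False using v t by (auto simp: extreme_point_of_def)
qed

lemma convex_cone_hull_insertE:
  assumes "x \<in> convex_cone hull (insert d S)"
  obtains c y where "c \<ge> 0" "y \<in> convex_cone hull S" "x = y + c *\<^sub>R d"
proof -
  have "x \<in> (\<Union>a\<in>convex_cone hull {d}. \<Union>y\<in>convex_cone hull S. {a + y})"
    using assms by (simp flip: convex_cone_hull_Un)
  then obtain a y where a: "a \<in> convex_cone hull {d}" "y \<in> convex_cone hull S" "x = a + y"
    by blast
  have "a \<in> insert 0 (\<Union>x\<in>{d}. \<Union>c\<in>{0..}. {c *\<^sub>R x})"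
    using a(1) by (simp add: convex_cone_hull_convex_hull)
  then have "\<exists>c\<ge>0. a = c *\<^sub>R d"
    using scaleR_zero_left[of d] by force
  then obtain c where "c \<ge> 0" "a = c *\<^sub>R d" by blast
  with a show thesis by (intro that[of c y]) (auto simp: add.commute)
qed

text \<open>The direction \<open>u - v\<close> spans an extreme ray of the cone of \<open>P\<close>
  at \<open>v\<close>. If a point of the segment lies strictly between \<open>a\<close> and
  \<open>b\<close> in \<open>P\<close>, the parts of \<open>a - v\<close> and \<open>b - v\<close>
  in the cone of \<open>S\<close> combine to a multiple of \<open>u - v\<close>. This multiple is
  not positive by \<open>notin\<close>, so pointedness removes the part of \<open>a - v\<close>.
  Hence \<open>a\<close> lies on the ray from \<open>v\<close> through \<open>u\<close>, and
  extremality of \<open>u\<close> keeps it from passing \<open>u\<close>. Exchanging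
  \<open>a\<close> and \<open>b\<close> gives the rest.\<close>

lemma face_of_closed_segment_extremal_direction:
  fixes v u :: "'a::euclidean_space"
  assumes P: "convex P" and v: "v extreme_point_of P" and u: "u extreme_point_of P" and "u \<noteq> v"
    and SP: "S \<subseteq> tangent_cone P v" and sub: "\<And>x. x \<in> P \<Longrightarrow> x - v \<in> convex_cone hull (insert (u - v) S)"
    and notin: "u - v \<notin> convex_cone hull S"
  shows "closed_segment v u face_of P"
proof -
  have vP: "v \<in> P" and uP: "u \<in> P" using u v by (auto simp: extreme_point_of_def)
  have cc: "convex_cone (tangent_cone P v)" using P vP by (rule convex_cone_tangent_cone)
  have Ksub: "convex_cone hull S \<subseteq> tangent_cone P v"
    using SP cc by (rule hull_minimal)
  have d: "u - v \<in> tangent_cone P v"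
    using uP by (auto simp: tangent_cone_def intro!: exI[of _ 1])
  have key: "a \<in> closed_segment v u"
    if ab: "a \<in> P" "b \<in> P" "x \<in> closed_segment v u" and x: "x \<in> open_segment a b" for a b x
  proof -
    obtain t where t: "0 < t" "t < 1" "x = (1 - t) *\<^sub>R a + t *\<^sub>R b"
      using x by (auto simp: in_segment)
    obtain r where r: "0 \<le> r" "r \<le> 1" "x = (1 - r) *\<^sub>R v + r *\<^sub>R u"
      using ab by (auto simp: in_segment)
    obtain p y where p: "p \<ge> 0" "y \<in> convex_cone hull S" "a - v = y + p *\<^sub>R (u - v)"
      using sub[OF ab(1)] by (rule convex_cone_hull_insertE)
    obtain q z where q: "q \<ge> 0" "z \<in> convex_cone hull S" "b - v = z + q *\<^sub>R (u - v)"
      using sub[OF ab(2)] by (rule convex_cone_hull_insertE)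
    \<comment> \<open>Expanding \<open>x - v\<close> once along the segment and once through
      \<open>a\<close> and \<open>b\<close> leaves \<open>e\<close> as the coefficient in
      \<open>s = e (u - v)\<close>.\<close>
    define e where "e = r - (1 - t) * p - t * q"
    define s where "s = (1 - t) *\<^sub>R y + t *\<^sub>R z"
    have "r *\<^sub>R (u - v) = x - v" using r(3) by (simp add: algebra_simps)
    also have "\<dots> = (1 - t) *\<^sub>R (a - v) + t *\<^sub>R (b - v)" using t(3) by (simp add: algebra_simps)
    also have "\<dots> = s + ((1 - t) * p + t * q) *\<^sub>R (u - v)"
      unfolding p q s_def by (simp add: algebra_simps)
    finally have "s = r *\<^sub>R (u - v) - ((1 - t) * p + t * q) *\<^sub>R (u - v)" by simp
    also have "\<dots> = e *\<^sub>R (u - v)" by (simp add: e_def scaleR_left_diff_distrib scaleR_left_distrib)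
    finally have se: "s = e *\<^sub>R (u - v)" .
    have yK: "(1 - t) *\<^sub>R y \<in> convex_cone hull S" and zK: "t *\<^sub>R z \<in> convex_cone hull S"
      using t p q by (auto intro: convex_cone_hull_mul)
    then have sK: "s \<in> convex_cone hull S" unfolding s_def by (rule convex_cone_hull_add)
    have "e \<le> 0"
    proof (rule ccontr)
      assume "\<not> e \<le> 0"
      then have "(1 / e) *\<^sub>R s = u - v" by (simp add: se)
      then show False using notin convex_cone_hull_mul[OF sK, of "1 / e"] \<open>\<not> e \<le> 0\<close> by simp
    qed
    \<comment> \<open>As \<open>e\<close> is not positive, \<open>t z - e (u - v)\<close> is again a
      tangent direction, and it is the negative of \<open>(1 - t) y\<close>.\<close>
    have "(1 - t) *\<^sub>R y = 0"
    proof (rule tangent_cone_pointed[OF P v])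
      show "(1 - t) *\<^sub>R y \<in> tangent_cone P v" using yK Ksub by blast
      have "t *\<^sub>R z + (- e) *\<^sub>R (u - v) \<in> tangent_cone P v"
        using zK Ksub d \<open>e \<le> 0\<close>
        by (intro convex_cone_add[OF cc] convex_cone_scaleR[OF cc _ d]) auto
      moreover have "- ((1 - t) *\<^sub>R y) = t *\<^sub>R z - s" by (simp add: s_def)
      ultimately show "- ((1 - t) *\<^sub>R y) \<in> tangent_cone P v" by (simp add: se)
    qed
    then have "y = 0" using t by simp
    then have a: "a = v + p *\<^sub>R (u - v)" using p by (simp add: algebra_simps)
    \<comment> \<open>Otherwise \<open>u\<close> would lie strictly between the points
      \<open>v\<close> and \<open>a\<close> of \<open>P\<close>.\<close>
    have "p \<le> 1"
    proof (rule ccontr)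
      assume "\<not> p \<le> 1"
      then have "u = (1 - 1 / p) *\<^sub>R v + (1 / p) *\<^sub>R a"
        unfolding a by (simp add: algebra_simps)
      moreover have "v \<noteq> a" using a \<open>\<not> p \<le> 1\<close> \<open>u \<noteq> v\<close> by simp
      ultimately have "u \<in> open_segment v a"
        using \<open>\<not> p \<le> 1\<close> by (auto simp: in_segment intro!: exI[of _ "1 / p"])
      then show False using u vP ab by (auto simp: extreme_point_of_def)
    qed
    then show ?thesis
      using p a by (auto simp: in_segment algebra_simps intro!: exI[of _ p])
  qed
  show ?thesis
    unfolding face_of_def
  proof (intro conjI ballI impI)
    show "closed_segment v u \<subseteq> P" using vP uP P by (rule closed_segment_subset)
    show "convex (closed_segment v u)" by (rule convex_closed_segment)
    fix a b x assume "a \<in> P" "b \<in> P" "x \<in> closed_segment v u" "x \<in> open_segment a b"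
    then show "a \<in> closed_segment v u" "b \<in> closed_segment v u"
      using key[of a b x] key[of b a x] by (auto simp: open_segment_commute)
  qed
qed

section \<open>Vertices, neighbours and improving edges of a polytope\<close>

lemma finite_vertices: "polytope P \<Longrightarrow> finite (vertices P)"
  unfolding polytope_def vertices_def
  by (metis extreme_points_of_convex_hull finite_subset)

lemma polytope_eq_convex_hull_vertices: "polytope P \<Longrightarrow> P = convex hull (vertices P)"
  unfolding vertices_def
  by (intro Krein_Milman_Minkowski polytope_imp_compact polytope_imp_convex)

lemma vertices_nonempty: "polytope P \<Longrightarrow> P \<noteq> {} \<Longrightarrow> vertices P \<noteq> {}"
  by (metis convex_hull_empty polytope_eq_convex_hull_vertices)

lemma Nb_commute: "u \<in> Nb P v \<longleftrightarrow> v \<in> Nb P u"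
  by (simp add: Nb_def closed_segment_commute)

lemma Nb_neq: "u \<in> Nb P v \<Longrightarrow> u \<noteq> v"
  by (auto simp: Nb_def edge_of_def)

lemma Nb_vertices: "u \<in> Nb P v \<Longrightarrow> u \<in> vertices P"
  using extreme_point_of_face[of "closed_segment u v" P u] extreme_point_of_segment[of u u v]
  by (simp add: Nb_def edge_of_def vertices_def)

lemma Nb_vertices': "u \<in> Nb P v \<Longrightarrow> v \<in> vertices P"
  using Nb_commute Nb_vertices by blast

text \<open>Among the sets of vertices whose directions from \<open>v\<close> generate the cone of
  \<open>P\<close> at \<open>v\<close>, one of least cardinality consists of neighbours of
  \<open>v\<close>, since none of its directions is generated by the others. If \<open>w\<close>
  increased along none of these directions, it would be nonpositive on the whole cone, contradicting
  \<open>x\<close>.\<close>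

lemma improving_neighbour_exists:
  assumes P: "polytope P" and v: "v \<in> vertices P" and x: "x \<in> P" "w \<bullet> x > w \<bullet> v"
  shows "\<exists>u\<in>Nb P v. w \<bullet> u > w \<bullet> v"
proof -
  define gen where "gen U \<longleftrightarrow> U \<subseteq> vertices P \<and>
    (\<lambda>x. x - v) ` P \<subseteq> convex_cone hull ((\<lambda>x. x - v) ` U)" for U
  have Pc: "convex P" using P by (rule polytope_imp_convex)
  have vext: "v extreme_point_of P" using v by (simp add: vertices_def)
  have "(\<lambda>x. x - v) ` P = convex hull ((\<lambda>x. x - v) ` vertices P)"
    using convex_hull_translation[of "- v" "vertices P"] polytope_eq_convex_hull_vertices[OF P]
    by simp
  then have "gen (vertices P)"
    unfolding gen_def using convex_hull_subset_convex_cone_hull by simp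
  then obtain U where U: "gen U" and minU: "\<And>U'. gen U' \<Longrightarrow> card U \<le> card U'"
    using ex_has_least_nat[of gen _ card] by blast
  have finU: "finite U" using U finite_vertices[OF P] by (auto simp: gen_def intro: finite_subset)
  have nb: "u \<in> Nb P v" if "u \<in> U" for u
  proof -
    let ?S = "(\<lambda>x. x - v) ` (U - {u})"
    have ins: "(\<lambda>x. x - v) ` U = insert (u - v) ?S"
      using that by (metis image_insert insert_Diff)
    \<comment> \<open>Otherwise \<open>u\<close> could be dropped from \<open>U\<close>, against the
      minimality of its cardinality.\<close>
    have notin: "u - v \<notin> convex_cone hull ?S"
    proof
      assume "u - v \<in> convex_cone hull ?S"
      then have "insert (u - v) ?S \<subseteq> convex_cone hull ?S"
        by (simp add: hull_subset)
      then have "convex_cone hull (insert (u - v) ?S) \<subseteq> convex_cone hull ?S"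
        using convex_cone_convex_cone_hull by (rule hull_minimal)
      then have "gen (U - {u})" using U ins unfolding gen_def by auto
      then have "card U \<le> card (U - {u})" by (rule minU)
      then show False using that finU by (metis card_Diff1_less leD)
    qed
    \<comment> \<open>The zero direction lies in every cone hull, so \<open>notin\<close> also shows
      that \<open>v\<close> itself is not in \<open>U\<close>.\<close>
    have "u - v \<noteq> 0" using notin convex_cone_hull_contains_0 by metis
    then have "u \<noteq> v" by simp
    have uext: "u extreme_point_of P" using U that by (auto simp: gen_def vertices_def)
    have "?S \<subseteq> tangent_cone P v"
    proof
      fix z assume "z \<in> ?S"
      then obtain y where "y \<in> vertices P" "z = y - v" using U by (auto simp: gen_def)
      then show "z \<in> tangent_cone P v"
        by (auto simp: tangent_cone_def vertices_def extreme_point_of_def intro!: exI[of _ 1])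
    qed
    moreover have "y - v \<in> convex_cone hull (insert (u - v) ?S)" if "y \<in> P" for y
      using U that unfolding gen_def ins by auto
    ultimately have "closed_segment v u face_of P"
      using Pc vext uext \<open>u \<noteq> v\<close> notin by (intro face_of_closed_segment_extremal_direction) auto
    then show ?thesis
      using \<open>u \<noteq> v\<close> by (simp add: Nb_def edge_of_def closed_segment_commute segment_convex_hull aff_dim_convex_hull)
  qed
  have "\<exists>u\<in>U. w \<bullet> u > w \<bullet> v"
  proof (rule ccontr)
    assume "\<not> ?thesis"
    then have "(\<lambda>x. x - v) ` U \<subseteq> {y. w \<bullet> y \<le> 0}"
      by (auto simp: inner_diff_right not_less)
    then have "convex_cone hull ((\<lambda>x. x - v) ` U) \<subseteq> {y. w \<bullet> y \<le> 0}"
      using convex_cone_halfspace_le by (rule hull_minimal)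
    then have "w \<bullet> (x - v) \<le> 0" using U x unfolding gen_def by blast
    then show False using x by (simp add: inner_diff_right)
  qed
  then obtain u where "u \<in> U" "w \<bullet> u > w \<bullet> v" by blast
  then show ?thesis using nb by (intro bexI[of _ u])
qed

lemma Nb_subset: "Nb P v \<subseteq> vertices P"
  by (rule subsetI) (rule Nb_vertices)

text \<open>Genericity only compares adjacent vertices, so a tie between nonadjacent maximizers has
  to be excluded separately. Such a tie would give an objective near \<open>w\<close> for which a
  vertex is suboptimal without having an improving neighbour.\<close>

lemma generic_unique_max_vertex:
  assumes P: "polytope P" "P \<noteq> {}" and w: "generic P w"
  shows "\<exists>!v. v \<in> vertices P \<and> (\<forall>u\<in>vertices P. w \<bullet> u \<le> w \<bullet> v)"
proof -
  have fin: "finite (vertices P)" and ne: "vertices P \<noteq> {}"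
    using P finite_vertices vertices_nonempty by auto
  have "\<exists>v\<in>vertices P. \<forall>u\<in>vertices P. w \<bullet> u \<le> w \<bullet> v"
  proof -
    have "Max ((\<bullet>) w ` vertices P) \<in> (\<bullet>) w ` vertices P"
      using fin ne by (intro Max_in) auto
    then obtain v where v: "v \<in> vertices P" "Max ((\<bullet>) w ` vertices P) = w \<bullet> v" by blast
    have "w \<bullet> u \<le> w \<bullet> v" if "u \<in> vertices P" for u
      unfolding v(2)[symmetric] using fin that by simp
    with v(1) show ?thesis by blast
  qed
  moreover have "v = v'"
    if v: "v \<in> vertices P" "\<forall>u\<in>vertices P. w \<bullet> u \<le> w \<bullet> v"
    and v': "v' \<in> vertices P" "\<forall>u\<in>vertices P. w \<bullet> u \<le> w \<bullet> v'" for v v'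
  proof (rule ccontr)
    assume "v \<noteq> v'"
    have eq: "w \<bullet> v = w \<bullet> v'" using v v' by (simp add: order_antisym)
    \<comment> \<open>Tilting \<open>w\<close> slightly towards \<open>v' - v\<close> makes \<open>v\<close> suboptimal but still better than its
      neighbours.\<close>
    have less: "w \<bullet> u < w \<bullet> v" if "u \<in> Nb P v" for u
      using that v w Nb_vertices[OF that] by (auto simp: generic_def less_le)
    have "\<forall>\<^sub>F e in at_right 0. (w + e *\<^sub>R (v' - v)) \<bullet> u < (w + e *\<^sub>R (v' - v)) \<bullet> v"
      if "u \<in> Nb P v" for u
    proof -
      have "((\<lambda>e. (w + e *\<^sub>R (v' - v)) \<bullet> v - (w + e *\<^sub>R (v' - v)) \<bullet> u)
          \<longlongrightarrow> (w + 0 *\<^sub>R (v' - v)) \<bullet> v - (w + 0 *\<^sub>R (v' - v)) \<bullet> u) (at_right 0)"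
        by (intro tendsto_intros)
      then have "\<forall>\<^sub>F e in at_right 0. 0 < (w + e *\<^sub>R (v' - v)) \<bullet> v - (w + e *\<^sub>R (v' - v)) \<bullet> u"
        by (rule order_tendstoD) (use less[OF that] in simp)
      then show ?thesis by eventually_elim simp
    qed
    moreover have "finite (Nb P v)" using fin Nb_subset finite_subset by blast
    ultimately have "\<forall>\<^sub>F e in at_right 0. \<forall>u\<in>Nb P v. (w + e *\<^sub>R (v' - v)) \<bullet> u < (w + e *\<^sub>R (v' - v)) \<bullet> v"
      by (simp add: eventually_ball_finite)
    moreover have "\<forall>\<^sub>F e in at_right 0. (0::real) < e"
      by (simp add: eventually_at_right_less)
    ultimately have "\<forall>\<^sub>F e in at_right 0. 0 < e \<and> (\<forall>u\<in>Nb P v. (w + e *\<^sub>R (v' - v)) \<bullet> u < (w + e *\<^sub>R (v' - v)) \<bullet> v)"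
      by eventually_elim simp
    from eventually_happens'[OF trivial_limit_at_right_real this]
    obtain e :: real where e: "e > 0"
      "\<forall>u\<in>Nb P v. (w + e *\<^sub>R (v' - v)) \<bullet> u < (w + e *\<^sub>R (v' - v)) \<bullet> v"
      by blast
    \<comment> \<open>Since \<open>w\<close> does not distinguish \<open>v\<close> from
      \<open>v'\<close>, only the tilt contributes, by \<open>e\<close> times the squared
      distance.\<close>
    have "(w + e *\<^sub>R (v' - v)) \<bullet> v' - (w + e *\<^sub>R (v' - v)) \<bullet> v = e * ((v' - v) \<bullet> (v' - v))"
      using eq by (simp add: algebra_simps inner_commute)
    moreover have "\<dots> > 0" using e \<open>v \<noteq> v'\<close> by simp
    ultimately have "(w + e *\<^sub>R (v' - v)) \<bullet> v' > (w + e *\<^sub>R (v' - v)) \<bullet> v" by linarith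
    moreover have "v' \<in> P" using v' by (simp add: vertices_def extreme_point_of_def)
    ultimately show False
      using improving_neighbour_exists[OF P(1) v(1)] e(2) by (meson less_asym)
  qed
  ultimately show ?thesis by blast
qed

lemma
  assumes "polytope P" "P \<noteq> {}" "generic P w"
  shows v_opt_in: "v_opt P w \<in> vertices P"
    and v_opt_max: "u \<in> vertices P \<Longrightarrow> w \<bullet> u \<le> w \<bullet> v_opt P w"
    and v_opt_unique: "v \<in> vertices P \<Longrightarrow> (\<And>u. u \<in> vertices P \<Longrightarrow> w \<bullet> u \<le> w \<bullet> v) \<Longrightarrow> v = v_opt P w"
proof -
  note ex1 = generic_unique_max_vertex[OF assms]
  have *: "v_opt P w \<in> vertices P \<and> (\<forall>u\<in>vertices P. w \<bullet> u \<le> w \<bullet> v_opt P w)"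
    unfolding v_opt_def by (rule theI'[OF ex1])
  then show "v_opt P w \<in> vertices P" by (rule conjunct1)
  show "w \<bullet> u \<le> w \<bullet> v_opt P w" if "u \<in> vertices P" using * that by simp
  show "v = v_opt P w" if "v \<in> vertices P" "\<And>u. u \<in> vertices P \<Longrightarrow> w \<bullet> u \<le> w \<bullet> v"
    using the1_equality[OF ex1, of v] that by (simp add: v_opt_def)
qed

lemma improving_neighbour_not_opt:
  assumes P: "polytope P" "P \<noteq> {}" and w: "generic P w"
    and v: "v \<in> vertices P" "v \<noteq> v_opt P w"
  shows "\<exists>u\<in>Nb P v. w \<bullet> u > w \<bullet> v"
proof -
  obtain u where u: "u \<in> vertices P" "w \<bullet> u > w \<bullet> v"
    using v_opt_unique[OF P w v(1)] v(2) linorder_not_le by blast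
  then have "u \<in> P" by (simp add: vertices_def extreme_point_of_def)
  then show ?thesis using P(1) v(1) u(2) by (intro improving_neighbour_exists)
qed

text \<open>Induction on the height \<open>h\<close>. At the root itself \<open>f r = r\<close>
  supplies the exponent 1, as arborescences ask for a positive one.\<close>

lemma funpow_reaches_root:
  fixes h :: "'a \<Rightarrow> nat"
  assumes "v \<in> V" and step: "\<And>v. v \<in> V \<Longrightarrow> v \<noteq> r \<Longrightarrow> f v \<in> V \<and> h (f v) < h v" and "f r = r"
  shows "\<exists>k\<ge>1. (f ^^ k) v = r"
  using assms(1)
proof (induction "h v" arbitrary: v rule: less_induct)
  case less
  show ?case
  proof (cases "v = r")
    case True
    then have "(f ^^ 1) v = r" using \<open>f r = r\<close> by simp
    then show ?thesis by blast
  next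
    case False
    then obtain k where "(f ^^ k) (f v) = r"
      using less.hyps[of "f v"] step[OF less.prems] by blast
    then have "(f ^^ Suc k) v = r" by (simp add: funpow_swap1)
    moreover have "1 \<le> Suc k" by simp
    ultimately show ?thesis by blast
  qed
qed

text \<open>The number of vertices with larger objective value drops with every improving step and
  serves as height.\<close>

lemma improving_path_to_opt:
  assumes P: "polytope P" "P \<noteq> {}" and w: "generic P w" and v: "v \<in> vertices P"
    and f: "\<And>v. v \<in> vertices P \<Longrightarrow> v \<noteq> v_opt P w \<Longrightarrow> f v \<in> Nb P v \<and> w \<bullet> f v > w \<bullet> v"
    and fopt: "f (v_opt P w) = v_opt P w"
  shows "\<exists>k\<ge>1. (f ^^ k) v = v_opt P w"
proof (rule funpow_reaches_root[where f = f and h = "\<lambda>v. card {x\<in>vertices P. w \<bullet> x > w \<bullet> v}"])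
  fix v assume "v \<in> vertices P" "v \<noteq> v_opt P w"
  then have fv: "f v \<in> Nb P v" "w \<bullet> f v > w \<bullet> v" using f by auto
  then have "{x\<in>vertices P. w \<bullet> x > w \<bullet> f v} \<subset> {x\<in>vertices P. w \<bullet> x > w \<bullet> v}"
    using Nb_vertices[OF fv(1)] by auto
  then have "card {x\<in>vertices P. w \<bullet> x > w \<bullet> f v} < card {x\<in>vertices P. w \<bullet> x > w \<bullet> v}"
    using finite_vertices[OF P(1)] by (intro psubset_card_mono) auto
  then show "f v \<in> vertices P \<and> card {x\<in>vertices P. w \<bullet> x > w \<bullet> f v} < card {x\<in>vertices P. w \<bullet> x > w \<bullet> v}"
    using Nb_vertices[OF fv(1)] by simp
qed (fact v fopt)+

section \<open>Weak Minkowski summands of sweep polytopes\<close>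

abbreviation index_pairs :: "'a list \<Rightarrow> (nat \<times> nat) set" where
  "index_pairs ps \<equiv> {(i, j). i < j \<and> j < length ps}"

text \<open>For a list sorted by nonincreasing values of a functional, this point maximizes the
  functional over the sweep polytope.\<close>

definition sweep_vertex :: "'a::euclidean_space list \<Rightarrow> 'a" where
  "sweep_vertex ps = (\<Sum>(i, j) \<in> index_pairs ps. ps ! i - ps ! j)"

text \<open>The generators lead from an earlier to a later point, so a functional that is
  nonincreasing along the list is nonpositive on this cone.\<close>

definition order_cone :: "'a::euclidean_space list \<Rightarrow> 'a set" where
  "order_cone ps = convex_cone hull {ps ! j - ps ! i |i j. i < j \<and> j < length ps}"

lemma finite_index_pairs: "finite (index_pairs ps)"
  by (rule finite_subset[of _ "{..<length ps} \<times> {..<length ps}"]) auto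

lemma sweep_polytope_altdef:
  "sweep_polytope ps = {sum s (index_pairs ps) |s.
    \<forall>(i, j) \<in> index_pairs ps. s (i, j) \<in> closed_segment (ps ! i - ps ! j) (ps ! j - ps ! i)}"
  unfolding sweep_polytope_def by (subst set_sum_alt[OF finite_index_pairs]) (simp add: case_prod_beta)

lemma polytope_set_plus:
  fixes A B :: "'a::euclidean_space set"
  assumes "polytope A" "polytope B"
  shows "polytope (A + B)"
  using assms unfolding polytope_def by (metis convex_hull_set_plus finite_set_plus)

lemma polytope_set_sum:
  fixes F :: "'b \<Rightarrow> 'a::euclidean_space set"
  shows "(\<And>i. i \<in> I \<Longrightarrow> polytope (F i)) \<Longrightarrow> polytope (sum F I)"
  by (induction I rule: infinite_finite_induct)
    (auto simp: polytope_set_plus polytope_sing)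

lemma polytope_sweep_polytope: "polytope (sweep_polytope ps)"
  unfolding sweep_polytope_def
  by (intro polytope_set_sum) (auto simp: segment_convex_hull polytope_convex_hull)

lemma sweep_vertex_in: "sweep_vertex ps \<in> sweep_polytope ps"
  unfolding sweep_polytope_altdef sweep_vertex_def by fastforce

text \<open>The summand \<open>ps ! i - ps ! j\<close> is replaced by \<open>0\<close>, the midpoint
  of its segment, and all other summands are kept.\<close>

lemma sweep_vertex_swap_in:
  assumes "i < j" "j < length ps"
  shows "sweep_vertex ps + (ps ! j - ps ! i) \<in> sweep_polytope ps"
proof -
  let ?s = "\<lambda>e. if e = (i, j) then 0 else ps ! fst e - ps ! snd e"
  have ij: "(i, j) \<in> index_pairs ps" using assms by simp
  have "sweep_vertex ps = (ps ! i - ps ! j) + (\<Sum>e \<in> index_pairs ps - {(i, j)}. ps ! fst e - ps ! snd e)"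
    unfolding sweep_vertex_def by (subst sum.remove[OF finite_index_pairs ij]) (simp add: case_prod_beta)
  also have "(\<Sum>e \<in> index_pairs ps - {(i, j)}. ps ! fst e - ps ! snd e) = sum ?s (index_pairs ps)"
    unfolding sum.remove[OF finite_index_pairs ij, of ?s] by (auto intro!: sum.cong)
  finally have "sweep_vertex ps + (ps ! j - ps ! i) = sum ?s (index_pairs ps)" by simp
  moreover have "0 \<in> closed_segment (p - q) (q - p)" for p q :: 'a
    using midpoint_in_closed_segment[of "p - q" "q - p"] by (simp add: midpoint_def)
  ultimately show ?thesis
    unfolding sweep_polytope_altdef by (auto intro!: exI[of _ ?s])
qed

lemma order_cone_subset_tangent_cone:
  "order_cone ps \<subseteq> tangent_cone (sweep_polytope ps) (sweep_vertex ps)"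
  unfolding order_cone_def
proof (rule hull_minimal)
  show "convex_cone (tangent_cone (sweep_polytope ps) (sweep_vertex ps))"
    by (intro convex_cone_tangent_cone polytope_imp_convex polytope_sweep_polytope sweep_vertex_in)
  show "{ps ! j - ps ! i |i j. i < j \<and> j < length ps} \<subseteq> tangent_cone (sweep_polytope ps) (sweep_vertex ps)"
    unfolding tangent_cone_def using sweep_vertex_swap_in by (fastforce intro: exI[of _ 1])
qed

abbreviation sorted_by :: "'a::real_inner \<Rightarrow> 'a list \<Rightarrow> bool" where
  "sorted_by w ps \<equiv> sorted_wrt (\<lambda>p q. w \<bullet> q \<le> w \<bullet> p) ps"

text \<open>Each segment is maximized on its own, and \<open>w\<close> prefers the end that
  subtracts the later point from the earlier one.\<close>

lemma sweep_vertex_max: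
  assumes "sorted_by w ps" "x \<in> sweep_polytope ps"
  shows "w \<bullet> x \<le> w \<bullet> sweep_vertex ps"
proof -
  from assms(2) obtain s where x: "x = sum s (index_pairs ps)"
    and s: "\<And>i j. i < j \<Longrightarrow> j < length ps \<Longrightarrow> s (i, j) \<in> closed_segment (ps ! i - ps ! j) (ps ! j - ps ! i)"
    unfolding sweep_polytope_altdef by blast
  have "w \<bullet> s (i, j) \<le> w \<bullet> (ps ! i - ps ! j)" if ij: "i < j" "j < length ps" for i j
  proof -
    have le: "w \<bullet> (ps ! j - ps ! i) \<le> w \<bullet> (ps ! i - ps ! j)"
      using sorted_wrt_nth_less[OF assms(1) ij] by (simp add: inner_diff_right)
    have "closed_segment (ps ! i - ps ! j) (ps ! j - ps ! i) \<subseteq> {y. w \<bullet> y \<le> w \<bullet> (ps ! i - ps ! j)}"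
      using le by (intro closed_segment_subset convex_halfspace_le) auto
    then show ?thesis using s[OF ij] by blast
  qed
  then show ?thesis
    unfolding x sweep_vertex_def inner_sum_right by (intro sum_mono) auto
qed

section \<open>A criterion for weak Minkowski summands of sweep polytopes\<close>

lemma sorted_enumeration_exists:
  assumes "finite S"
  shows "\<exists>ps. distinct ps \<and> set ps = S \<and> sorted_by w ps"
proof -
  obtain xs where xs: "distinct xs" "set xs = S"
    using finite_distinct_list[OF assms] by blast
  have "sorted (map (\<lambda>p. - (w \<bullet> p)) (sort_key (\<lambda>p. - (w \<bullet> p)) xs))" by (rule sorted_sort_key)
  then have "sorted_by w (sort_key (\<lambda>p. - (w \<bullet> p)) xs)"
    by (simp add: sorted_map)
  then show ?thesis using xs by (intro exI[of _ "sort_key (\<lambda>p. - (w \<bullet> p)) xs"]) simp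
qed

lemma finite_enumerations: "finite S \<Longrightarrow> finite {ps. distinct ps \<and> set ps = S}"
  by (rule finite_subset[of _ "{ps. set ps \<subseteq> S \<and> length ps \<le> card S}"])
    (auto simp: distinct_card intro!: finite_lists_length_le)

text \<open>A point outside the hull would be strictly separated from it. Only finitely many strict
  inequalities are involved, so the separating functional can be moved into the dense set
  \<open>G\<close>. Sorting \<open>S\<close> by the new functional gives a sweep vertex at least as
  good as the point, a contradiction.\<close>

lemma SP_subset_convex_hull_sweep_vertices:
  assumes S: "finite S" and G: "closure G = UNIV"
  shows "SP S \<subseteq> convex hull {sweep_vertex ps |ps. distinct ps \<and> set ps = S \<and> (\<exists>w\<in>G. sorted_by w ps)}"
    (is "_ \<subseteq> convex hull ?V")
proof
  fix x assume x: "x \<in> SP S"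
  have fin: "finite ?V"
    using finite_enumerations[OF S]
    by (rule finite_subset[rotated, OF finite_imageI[where h = sweep_vertex]]) auto
  show "x \<in> convex hull ?V"
  proof (rule ccontr)
    assume "x \<notin> convex hull ?V"
    moreover have "closed (convex hull ?V)"
      using fin by (simp add: finite_imp_compact_convex_hull compact_imp_closed)
    ultimately obtain a b where ab: "a \<bullet> x < b" "\<forall>y \<in> convex hull ?V. a \<bullet> y > b"
      using separating_hyperplane_closed_point[of "convex hull ?V" x] by auto
    \<comment> \<open>\<open>N\<close> is the open set of functionals that strictly prefer
      \<open>x\<close> to all sweep vertices. The separating \<open>a\<close> is smaller at
      \<open>x\<close>, so it is \<open>- a\<close> that lies in \<open>N\<close>.\<close>
    define N where "N = (\<Inter>y\<in>?V. {w. w \<bullet> y < w \<bullet> x})"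
    have "open {w. w \<bullet> y < w \<bullet> x}" for y
      by (intro open_Collect_less continuous_intros)
    then have "open N" unfolding N_def using fin by (intro open_INT) auto
    moreover have "- a \<in> N"
      unfolding N_def using ab hull_subset[of ?V convex] by fastforce
    ultimately have "N \<inter> G \<noteq> {}" using G open_Int_closure_eq_empty by blast
    then obtain w where w: "w \<in> G" "w \<in> N" by blast
    obtain ps where ps: "distinct ps" "set ps = S" "sorted_by w ps"
      using sorted_enumeration_exists[OF S] by blast
    then have "w \<bullet> sweep_vertex ps < w \<bullet> x" using w unfolding N_def by blast
    moreover have "w \<bullet> x \<le> w \<bullet> sweep_vertex ps"
      using ps x by (intro sweep_vertex_max) (auto simp: SP_eq)
    ultimately show False by simp
  qed
qed

text \<open>The complementary summand has the points \<open>\<lambda> p - q\<close> as its generators, where \<open>p\<close> runs over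
  the vertices of the sweep polytope and \<open>q\<close> is the generator of the summand selected at \<open>p\<close>.\<close>

theorem weak_Minkowski_summand_SP:
  fixes S Q :: "'a::euclidean_space set"
  assumes S: "finite S" and Q: "finite Q" and G: "closure G = UNIV"
    and sel: "\<And>w ps. w \<in> G \<Longrightarrow> distinct ps \<Longrightarrow> set ps = S \<Longrightarrow> sorted_by w ps \<Longrightarrow>
      \<exists>q0\<in>Q. \<forall>q\<in>Q. q - q0 \<in> order_cone ps"
  shows "weak_Minkowski_summand (convex hull Q) (SP S)"
proof -
  define L where "L = {ps. distinct ps \<and> set ps = S \<and> (\<exists>w\<in>G. sorted_by w ps)}"
  have finL: "finite L"
    unfolding L_def by (rule finite_subset[OF _ finite_enumerations[OF S]]) auto
  obtain ps0 where ps0: "distinct ps0" "set ps0 = S" using finite_distinct_list[OF S] by blast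
  have poly: "polytope (SP S)" using SP_eq[OF ps0] polytope_sweep_polytope by simp
  have "\<forall>ps\<in>L. \<exists>q0\<in>Q. \<forall>q\<in>Q. q - q0 \<in> order_cone ps" unfolding L_def using sel by blast
  then obtain q0 where q0: "\<And>ps. ps \<in> L \<Longrightarrow> q0 ps \<in> Q"
    "\<And>ps q. ps \<in> L \<Longrightarrow> q \<in> Q \<Longrightarrow> q - q0 ps \<in> order_cone ps" by metis
  have "\<exists>l>0. \<forall>t. 0 \<le> t \<and> t \<le> l \<longrightarrow> sweep_vertex ps + t *\<^sub>R (q - q0 ps) \<in> SP S"
    if "ps \<in> L" "q \<in> Q" for ps q
  proof -
    have eq: "SP S = sweep_polytope ps" using that SP_eq by (auto simp: L_def)
    have "q - q0 ps \<in> tangent_cone (SP S) (sweep_vertex ps)"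
      using q0(2)[OF that] order_cone_subset_tangent_cone eq by auto
    then show ?thesis
      using tangent_coneE[OF polytope_imp_convex[OF poly]] sweep_vertex_in eq by metis
  qed
  then have "\<forall>e\<in>L \<times> Q. \<exists>l>0. \<forall>t. 0 \<le> t \<and> t \<le> l \<longrightarrow> sweep_vertex (fst e) + t *\<^sub>R (snd e - q0 (fst e)) \<in> SP S"
    by auto
  then obtain l where l: "\<And>e. e \<in> L \<times> Q \<Longrightarrow> l e > 0"
    "\<And>e t. e \<in> L \<times> Q \<Longrightarrow> 0 \<le> t \<Longrightarrow> t \<le> l e \<Longrightarrow> sweep_vertex (fst e) + t *\<^sub>R (snd e - q0 (fst e)) \<in> SP S"
    by metis
  \<comment> \<open>A step length that works for all orders and all points of \<open>Q\<close> at
    once. Inserting 1 makes the minimum well defined without a discussion of emptiness.\<close>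
  define m where "m = Min (insert (1::real) (l ` (L \<times> Q)))"
  have fin: "finite (insert 1 (l ` (L \<times> Q)))" using finL Q by simp
  have m0: "m > 0" unfolding m_def using fin l(1) by (subst Min_gr_iff) auto
  have m: "sweep_vertex ps + m *\<^sub>R (q - q0 ps) \<in> SP S" if "ps \<in> L" "q \<in> Q" for ps q
  proof -
    have "m \<le> l (ps, q)" unfolding m_def using fin that by (intro Min_le) auto
    then show ?thesis using l(2)[of "(ps, q)" m] that m0 by auto
  qed
  define r where "r ps = (1 / m) *\<^sub>R sweep_vertex ps - q0 ps" for ps
  have "(\<lambda>x. (1 / m) *\<^sub>R x) ` SP S = convex hull Q + convex hull (r ` L)"
  proof
    \<comment> \<open>One inclusion: each scaled sweep vertex splits as
      \<open>q0 ps + r ps\<close>.\<close>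
    have "SP S \<subseteq> convex hull (sweep_vertex ` L)"
      using SP_subset_convex_hull_sweep_vertices[OF S G] unfolding L_def by (simp add: setcompr_eq_image)
    then have "(\<lambda>x. (1 / m) *\<^sub>R x) ` SP S \<subseteq> convex hull ((\<lambda>x. (1 / m) *\<^sub>R x) ` sweep_vertex ` L)"
      unfolding convex_hull_scaling by (rule image_mono)
    also have "\<dots> \<subseteq> convex hull Q + convex hull (r ` L)"
    proof (rule hull_minimal)
      show "convex (convex hull Q + convex hull (r ` L))" by (intro convex_set_plus) auto
      show "(\<lambda>x. (1 / m) *\<^sub>R x) ` sweep_vertex ` L \<subseteq> convex hull Q + convex hull (r ` L)"
      proof clarify
        fix ps assume "ps \<in> L"
        then have "q0 ps + r ps \<in> convex hull Q + convex hull (r ` L)"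
          using q0 by (intro set_plus_intro hull_inc) auto
        then show "(1 / m) *\<^sub>R sweep_vertex ps \<in> convex hull Q + convex hull (r ` L)"
          by (simp add: r_def)
      qed
    qed
    finally show "(\<lambda>x. (1 / m) *\<^sub>R x) ` SP S \<subseteq> convex hull Q + convex hull (r ` L)" .
    \<comment> \<open>The other inclusion: \<open>q + r ps\<close> is the scaled point
      \<open>sweep_vertex ps + m (q - q0 ps)\<close>, which lies in \<open>SP S\<close> by the
      choice of \<open>m\<close>.\<close>
    have "convex hull (Q + r ` L) \<subseteq> (\<lambda>x. (1 / m) *\<^sub>R x) ` SP S"
    proof (rule hull_minimal)
      show "convex ((\<lambda>x. (1 / m) *\<^sub>R x) ` SP S)"
        using poly by (intro convex_scaling polytope_imp_convex)
      show "Q + r ` L \<subseteq> (\<lambda>x. (1 / m) *\<^sub>R x) ` SP S"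
      proof
        fix z assume "z \<in> Q + r ` L"
        then obtain q ps where z: "q \<in> Q" "ps \<in> L" "z = q + r ps"
          by (auto simp: set_plus_def)
        have "z = (1 / m) *\<^sub>R (sweep_vertex ps + m *\<^sub>R (q - q0 ps))"
          unfolding z r_def using m0 by (simp add: algebra_simps)
        then show "z \<in> (\<lambda>x. (1 / m) *\<^sub>R x) ` SP S" using m z by blast
      qed
    qed
    then show "convex hull Q + convex hull (r ` L) \<subseteq> (\<lambda>x. (1 / m) *\<^sub>R x) ` SP S"
      by (simp add: convex_hull_set_plus)
  qed
  then show ?thesis
    unfolding weak_Minkowski_summand_def
    using poly Q finL m0 polytope_convex_hull
    by (intro conjI exI[of _ "1 / m"] exI[of _ "convex hull (r ` L)"]) auto
qed

section \<open>Membership in the order cone\<close>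

lemma order_cone_add: "x \<in> order_cone ps \<Longrightarrow> y \<in> order_cone ps \<Longrightarrow> x + y \<in> order_cone ps"
  unfolding order_cone_def by (rule convex_cone_hull_add)

lemma order_cone_scaleR: "x \<in> order_cone ps \<Longrightarrow> 0 \<le> r \<Longrightarrow> r *\<^sub>R x \<in> order_cone ps"
  unfolding order_cone_def by (rule convex_cone_hull_mul)

lemma zero_in_order_cone: "0 \<in> order_cone ps"
  unfolding order_cone_def by (rule convex_cone_hull_contains_0)

lemma order_cone_sum:
  "(\<And>i. i \<in> I \<Longrightarrow> f i \<in> order_cone ps) \<Longrightarrow> sum f I \<in> order_cone ps"
  by (induction I rule: infinite_finite_induct) (auto simp: order_cone_add zero_in_order_cone)

lemma order_cone_diff:
  assumes "i \<le> j" "j < length ps"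
  shows "ps ! j - ps ! i \<in> order_cone ps"
proof (cases "i = j")
  case True
  then show ?thesis by (simp add: zero_in_order_cone)
next
  case False
  with assms show ?thesis unfolding order_cone_def by (intro hull_inc CollectI exI[of _ i] exI[of _ j]) simp
qed

lemma order_cone_inner_le:
  assumes "sorted_by w ps" "z \<in> order_cone ps"
  shows "w \<bullet> z \<le> 0"
proof -
  have "{ps ! j - ps ! i |i j. i < j \<and> j < length ps} \<subseteq> {z. w \<bullet> z \<le> 0}"
    using sorted_wrt_nth_less[OF assms(1)] by (auto simp: inner_diff_right)
  then have "order_cone ps \<subseteq> {z. w \<bullet> z \<le> 0}"
    unfolding order_cone_def using convex_cone_halfspace_le by (rule hull_minimal)
  then show ?thesis using assms(2) by blast
qed

text \<open>The strict inequality excludes a tie, so \<open>p\<close> has to come before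
  \<open>q\<close> in the list.\<close>

lemma order_cone_diff_less:
  assumes "sorted_by w ps" "p \<in> set ps" "q \<in> set ps" "w \<bullet> q < w \<bullet> p"
  shows "q - p \<in> order_cone ps"
proof -
  obtain i j where i: "i < length ps" "ps ! i = p" and j: "j < length ps" "ps ! j = q"
    using assms(2,3) by (auto simp: in_set_conv_nth)
  have "\<not> j < i"
    using sorted_wrt_nth_less[OF assms(1), of j i] i j assms(4) by auto
  then show ?thesis using order_cone_diff[of i j ps] i j by simp
qed

text \<open>Take the element of \<open>D\<close> whose image has the smallest index. This is the
  greedy choice made at a single vertex of the polytope.\<close>

lemma first_in_order:
  assumes "D \<noteq> {}" "f ` D \<subseteq> set ps"
  shows "\<exists>u\<in>D. \<forall>u'\<in>D. f u' - f u \<in> order_cone ps"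
proof -
  have "\<forall>u\<in>D. \<exists>i. i < length ps \<and> ps ! i = f u"
    using assms(2) by (auto simp: in_set_conv_nth subset_iff)
  then obtain i where i: "\<And>u. u \<in> D \<Longrightarrow> i u < length ps \<and> ps ! i u = f u" by metis
  obtain u where u: "u \<in> D" "\<And>u'. u' \<in> D \<Longrightarrow> i u \<le> i u'"
    using ex_has_least_nat[of "\<lambda>u. u \<in> D" _ i] assms(1) by blast
  have "f u' - f u \<in> order_cone ps" if "u' \<in> D" for u'
    using order_cone_diff[of "i u" "i u'" ps] u(2)[OF that] i[OF u(1)] i[OF that] by simp
  with u(1) show ?thesis by blast
qed

text \<open>Abel summation: each point is \<open>ps ! 0\<close> plus consecutive increments. In the
  difference of the sums \<open>ps ! 0\<close> cancels because the cardinalities agree, and the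
  increment ending at index \<open>k\<close> is multiplied by the surplus of indices at least
  \<open>k\<close> in \<open>U\<close> over those in \<open>W\<close>, which \<open>le\<close> makes
  nonnegative.\<close>

lemma order_cone_sum_diff:
  fixes ps :: "'a::euclidean_space list" and x :: "'b \<Rightarrow> nat" and y :: "'c \<Rightarrow> nat"
  assumes fin: "finite U" "finite W" and card: "card U = card W"
    and x: "\<And>u. u \<in> U \<Longrightarrow> x u < length ps" and y: "\<And>u. u \<in> W \<Longrightarrow> y u < length ps"
    and le: "\<And>k. card {u\<in>W. k \<le> y u} \<le> card {u\<in>U. k \<le> x u}"
  shows "(\<Sum>u\<in>U. ps ! x u) - (\<Sum>u\<in>W. ps ! y u) \<in> order_cone ps"
proof -
  let ?m = "length ps"
  \<comment> \<open>The indicator makes the range of summation independent of \<open>i\<close>, so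
    that the sums can be exchanged below. As \<open>k\<close> starts at 1, the subtraction
    \<open>k - 1\<close> does not truncate.\<close>
  have tele: "ps ! i = ps ! 0 + (\<Sum>k = 1..<?m. of_bool (k \<le> i) *\<^sub>R (ps ! k - ps ! (k - 1)))"
    if "i < ?m" for i
  proof -
    have "(\<Sum>k = 1..<?m. of_bool (k \<le> i) *\<^sub>R (ps ! k - ps ! (k - 1)))
        = (\<Sum>k = 1..i. ps ! k - ps ! (k - 1))"
      using that by (intro sum.mono_neutral_cong_right) auto
    also have "\<dots> = ps ! i - ps ! 0"
      by (induction i) auto
    finally show ?thesis by simp
  qed
  \<comment> \<open>The separate type \<open>'d\<close> allows the formula to be used for both
    \<open>U\<close> and \<open>W\<close>.\<close>
  have sum: "(\<Sum>u\<in>A. ps ! z u) = real (card A) *\<^sub>R ps ! 0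
      + (\<Sum>k = 1..<?m. real (card {u\<in>A. k \<le> z u}) *\<^sub>R (ps ! k - ps ! (k - 1)))"
    if A: "finite A" "\<And>u. u \<in> A \<Longrightarrow> z u < ?m" for A :: "'d set" and z
  proof -
    have "(\<Sum>u\<in>A. ps ! z u)
        = (\<Sum>u\<in>A. ps ! 0 + (\<Sum>k = 1..<?m. of_bool (k \<le> z u) *\<^sub>R (ps ! k - ps ! (k - 1))))"
      using tele A by (intro sum.cong) auto
    also have "\<dots> = real (card A) *\<^sub>R ps ! 0
        + (\<Sum>k = 1..<?m. \<Sum>u\<in>A. of_bool (k \<le> z u) *\<^sub>R (ps ! k - ps ! (k - 1)))"
      by (simp add: sum.distrib sum_constant_scaleR sum.swap[of _ _ A])
    also have "(\<lambda>k. \<Sum>u\<in>A. of_bool (k \<le> z u) *\<^sub>R (ps ! k - ps ! (k - 1)))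
        = (\<lambda>k. real (card {u\<in>A. k \<le> z u}) *\<^sub>R (ps ! k - ps ! (k - 1)))"
      using A(1) by (simp add: Int_def flip: scaleR_sum_left)
    finally show ?thesis .
  qed
  have "(\<Sum>u\<in>U. ps ! x u) - (\<Sum>u\<in>W. ps ! y u)
      = (\<Sum>k = 1..<?m. (real (card {u\<in>U. k \<le> x u}) - real (card {u\<in>W. k \<le> y u})) *\<^sub>R (ps ! k - ps ! (k - 1)))"
    using sum[of U x, OF fin(1) x] sum[of W y, OF fin(2) y] card
    by (simp add: scaleR_left_diff_distrib sum_subtractf)
  also have "\<dots> \<in> order_cone ps"
    using le by (intro order_cone_sum order_cone_scaleR order_cone_diff) auto
  finally show ?thesis .
qed

section \<open>Minimum spanning trees\<close>

lemma rtrancl_crossing: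
  assumes "(x, y) \<in> R\<^sup>*" "x \<in> A" "y \<notin> A"
  shows "\<exists>a b. (a, b) \<in> R \<and> a \<in> A \<and> b \<notin> A"
  using assms by (induction rule: rtrancl_induct) auto

text \<open>Its connected components are those formed by Kruskal's algorithm once all edges of rank
  less than \<open>k\<close> have been processed.\<close>

definition below :: "('a \<times> 'a) set \<Rightarrow> ('a \<Rightarrow> 'a \<Rightarrow> nat) \<Rightarrow> nat \<Rightarrow> ('a \<times> 'a) set" where
  "below R \<rho> k = {(x, y) \<in> R. \<rho> x y < k}"

lemma sym_below: "sym R \<Longrightarrow> (\<And>x y. (x, y) \<in> R \<Longrightarrow> \<rho> x y = \<rho> y x) \<Longrightarrow> sym (below R \<rho> k)"
  by (fastforce simp: below_def sym_def)

text \<open>Exits are the roots of the forest left when the tree edges of rank at least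
  \<open>k\<close> are removed. The root \<open>r\<close> is listed separately because
  \<open>T r = r\<close> is not an edge.\<close>

definition is_exit :: "('a \<Rightarrow> 'a \<Rightarrow> nat) \<Rightarrow> 'a \<Rightarrow> ('a \<Rightarrow> 'a) \<Rightarrow> nat \<Rightarrow> 'a \<Rightarrow> bool" where
  "is_exit \<rho> r T k x \<longleftrightarrow> x = r \<or> k \<le> \<rho> x (T x)"

text \<open>The height \<open>h\<close> certifies that \<open>T\<close> is acyclic. The last clause
  encodes minimality: at every level a component of the graph below \<open>k\<close> has at most one
  exit in \<open>A\<close>.\<close>

definition prim_tree :: "('a \<times> 'a) set \<Rightarrow> ('a \<Rightarrow> 'a \<Rightarrow> nat) \<Rightarrow> 'a \<Rightarrow> 'a set \<Rightarrow> ('a \<Rightarrow> 'a) \<Rightarrow> ('a \<Rightarrow> nat) \<Rightarrow> bool" where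
  "prim_tree R \<rho> r A T h \<longleftrightarrow> r \<in> A \<and> T r = r \<and>
    (\<forall>x\<in>A - {r}. T x \<in> A \<and> (x, T x) \<in> R \<and> h (T x) < h x) \<and>
    (\<forall>k. \<forall>x\<in>A. \<forall>y\<in>A. is_exit \<rho> r T k x \<longrightarrow> is_exit \<rho> r T k y \<longrightarrow> (x, y) \<in> (below R \<rho> k)\<^sup>* \<longrightarrow> x = y)"

lemma prim_treeD:
  assumes "prim_tree R \<rho> r A T h"
  shows "r \<in> A" "T r = r"
    and "x \<in> A \<Longrightarrow> x \<noteq> r \<Longrightarrow> T x \<in> A \<and> (x, T x) \<in> R \<and> h (T x) < h x"
    and "x \<in> A \<Longrightarrow> y \<in> A \<Longrightarrow> is_exit \<rho> r T k x \<Longrightarrow> is_exit \<rho> r T k y \<Longrightarrow>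
      (x, y) \<in> (below R \<rho> k)\<^sup>* \<Longrightarrow> x = y"
  using assms unfolding prim_tree_def by blast+

text \<open>Prim's algorithm. Each new vertex is attached by a crossing edge of minimal rank, so it can
  only be an exit at level \<open>k\<close> if no vertex of its component at this level has been attached
  before.\<close>

lemma prim_tree_partial:
  fixes \<rho> :: "'a \<Rightarrow> 'a \<Rightarrow> nat"
  assumes V: "finite V" "r \<in> V" and R: "R \<subseteq> V \<times> V" "sym R"
    and \<rho>: "\<And>x y. (x, y) \<in> R \<Longrightarrow> \<rho> x y = \<rho> y x"
    and conn: "\<And>x. x \<in> V \<Longrightarrow> (r, x) \<in> R\<^sup>*"
    and n: "1 \<le> n" "n \<le> card V"
  shows "\<exists>A T h. A \<subseteq> V \<and> card A = n \<and> prim_tree R \<rho> r A T h"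
  using n
proof (induction n rule: dec_induct)
  case base
  show ?case
    using V by (intro exI[of _ "{r}"] exI[of _ id] exI[of _ "\<lambda>_. 0"])
      (auto simp: prim_tree_def)
next
  case (step n)
  then obtain A T h where A: "A \<subseteq> V" "card A = n" and ptree: "prim_tree R \<rho> r A T h"
    by auto
  note tree = prim_treeD(3)[OF ptree] and exit = prim_treeD(4)[OF ptree]
  have "A \<noteq> V" using A step.prems by auto
  then obtain z where "z \<in> V" "z \<notin> A" using A by blast
  then obtain a0 b0 where "(a0, b0) \<in> R" "a0 \<in> A" "b0 \<notin> A"
    using rtrancl_crossing[OF conn[of z] prim_treeD(1)[OF ptree]] by blast
  then obtain e where e: "e \<in> {(a, b) \<in> R. a \<in> A \<and> b \<notin> A}"
    and emin: "\<And>e'. e' \<in> {(a, b) \<in> R. a \<in> A \<and> b \<notin> A} \<Longrightarrow> case_prod \<rho> e \<le> case_prod \<rho> e'"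
    using ex_has_least_nat[of "\<lambda>e. e \<in> {(a, b) \<in> R. a \<in> A \<and> b \<notin> A}" "(a0, b0)" "case_prod \<rho>"] by blast
  obtain u v where uv: "(u, v) \<in> R" "u \<in> A" "v \<notin> A"
    and min: "\<And>a b. (a, b) \<in> R \<Longrightarrow> a \<in> A \<Longrightarrow> b \<notin> A \<Longrightarrow> \<rho> u v \<le> \<rho> a b"
    using e emin by (cases e) fastforce
  have vu: "(v, u) \<in> R" "\<rho> v u = \<rho> u v" using uv R(2) \<rho> by (auto simp: sym_def)
  \<comment> \<open>The new vertex hangs one above its parent, so heights still decrease along the
    tree.\<close>
  let ?T = "T(v := u)" and ?h = "h(v := Suc (h u))"
  \<comment> \<open>A path below level \<open>k\<close> from \<open>A\<close> to \<open>v\<close>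
    would leave \<open>A\<close> by an edge of rank less than that of the minimal crossing
    edge.\<close>
  have fresh: "(x, v) \<notin> (below R \<rho> k)\<^sup>*" if "x \<in> A" "k \<le> \<rho> v u" for x k
  proof
    assume "(x, v) \<in> (below R \<rho> k)\<^sup>*"
    from rtrancl_crossing[OF this that(1) uv(3)]
    obtain a b where "(a, b) \<in> below R \<rho> k" "a \<in> A" "b \<notin> A" by blast
    then have "\<rho> u v < k" using min[of a b] by (auto simp: below_def)
    then show False using that(2) vu(2) by simp
  qed
  have symk: "(y, x) \<in> (below R \<rho> k)\<^sup>*" if "(x, y) \<in> (below R \<rho> k)\<^sup>*" for x y k
    using that sym_rtrancl[OF sym_below[of R \<rho>, OF R(2) \<rho>]] by (auto dest: symD)
  have "v \<noteq> r" using uv prim_treeD(1)[OF ptree] by auto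
  have nv: "x \<noteq> v" if "x \<in> A" for x using that uv by auto
  \<comment> \<open>Vertices of \<open>A\<close> keep their status because \<open>T\<close> changes
    only at \<open>v\<close>; a pair containing \<open>v\<close> and a vertex of \<open>A\<close> is
    excluded by \<open>fresh\<close>.\<close>
  have exit': "x = y"
    if "x \<in> insert v A" "y \<in> insert v A" "is_exit \<rho> r ?T k x" "is_exit \<rho> r ?T k y"
      "(x, y) \<in> (below R \<rho> k)\<^sup>*" for k x y
  proof (cases "x = v")
    case True
    then show ?thesis
      using that fresh[of y k] symk \<open>v \<noteq> r\<close> by (cases "y = v") (auto simp: is_exit_def)
  next
    case False
    then have "x \<in> A" using that by simp
    show ?thesis
    proof (cases "y = v")
      case True
      then show ?thesis using that fresh[OF \<open>x \<in> A\<close>, of k] \<open>v \<noteq> r\<close> by (auto simp: is_exit_def)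
    next
      case False
      then show ?thesis using that exit[of x y k] \<open>x \<in> A\<close> nv[OF \<open>x \<in> A\<close>]
        by (auto simp: is_exit_def)
    qed
  qed
  have tree': "?T x \<in> insert v A \<and> (x, ?T x) \<in> R \<and> ?h (?T x) < ?h x"
    if "x \<in> insert v A - {r}" for x
  proof (cases "x = v")
    case True
    then show ?thesis using uv vu nv[of u] by auto
  next
    case False
    then show ?thesis using that tree[of x] nv[of "T x"] by auto
  qed
  have "finite A" using A V finite_subset by blast
  then have "card (insert v A) = Suc n" using A uv by simp
  moreover have "insert v A \<subseteq> V" using A uv R by auto
  moreover have "prim_tree R \<rho> r (insert v A) ?T ?h"
    unfolding prim_tree_def
  proof (intro conjI ballI allI impI)
    show "r \<in> insert v A" using prim_treeD(1)[OF ptree] by simp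
    show "?T r = r" using prim_treeD(2)[OF ptree] \<open>v \<noteq> r\<close> by simp
    fix x assume "x \<in> insert v A - {r}"
    from tree'[OF this] show "?T x \<in> insert v A" "(x, ?T x) \<in> R" "?h (?T x) < ?h x" by auto
  qed (rule exit')
  ultimately show ?case by blast
qed

text \<open>A partial tree with \<open>card V\<close> vertices is spanning; the height is then
  replaced by the statement that iterating \<open>T\<close> reaches the root.\<close>

lemma prim_tree_exists:
  fixes \<rho> :: "'a \<Rightarrow> 'a \<Rightarrow> nat"
  assumes V: "finite V" "r \<in> V" and R: "R \<subseteq> V \<times> V" "sym R"
    and \<rho>: "\<And>x y. (x, y) \<in> R \<Longrightarrow> \<rho> x y = \<rho> y x"
    and conn: "\<And>x. x \<in> V \<Longrightarrow> (r, x) \<in> R\<^sup>*"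
  obtains T where "T r = r" "\<And>x. x \<in> V \<Longrightarrow> x \<noteq> r \<Longrightarrow> (x, T x) \<in> R"
    "\<And>x. x \<in> V \<Longrightarrow> \<exists>k\<ge>1. (T ^^ k) x = r"
    "\<And>k x y. x \<in> V \<Longrightarrow> y \<in> V \<Longrightarrow> is_exit \<rho> r T k x \<Longrightarrow> is_exit \<rho> r T k y \<Longrightarrow>
      (x, y) \<in> (below R \<rho> k)\<^sup>* \<Longrightarrow> x = y"
proof -
  have "1 \<le> card V" using V by (metis One_nat_def Suc_leI card_gt_0_iff empty_iff)
  from prim_tree_partial[of V r R \<rho>, OF assms this order_refl]
  obtain A T h where A: "A \<subseteq> V" "card A = card V" and "prim_tree R \<rho> r A T h" by blast
  moreover have "A = V" using A V card_subset_eq by blast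
  ultimately have ptree: "prim_tree R \<rho> r V T h" by simp
  have "\<exists>k\<ge>1. (T ^^ k) x = r" if "x \<in> V" for x
    using that prim_treeD(2,3)[OF ptree] by (intro funpow_reaches_root[where h = h]) auto
  then show thesis using prim_treeD(2-4)[OF ptree] by (intro that[of T]) blast+
qed

section \<open>Comparison of two spanning trees by their exits\<close>

text \<open>Follow \<open>B\<close> from \<open>x\<close> until the root or an edge of rank at least
  \<open>k\<close> is met; all edges used before have rank below \<open>k\<close>.\<close>

lemma exit_vertex_exists:
  assumes "(B ^^ n) x = s" "x \<in> V" and R: "R \<subseteq> V \<times> V"
    and B: "\<And>x. x \<in> V \<Longrightarrow> x \<noteq> s \<Longrightarrow> (x, B x) \<in> R"
  shows "\<exists>y\<in>V. is_exit \<rho> s B k y \<and> (x, y) \<in> (below R \<rho> k)\<^sup>*"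
  using assms(1,2)
proof (induction n arbitrary: x)
  case 0
  then show ?case by (auto simp: is_exit_def)
next
  case (Suc n)
  show ?case
  proof (cases "is_exit \<rho> s B k x")
    case True
    then show ?thesis using Suc.prems by blast
  next
    case False
    then have "(x, B x) \<in> below R \<rho> k" "(x, B x) \<in> R" using B Suc.prems by (auto simp: below_def is_exit_def)
    moreover have "(B ^^ n) (B x) = s" using Suc.prems by (simp add: funpow_swap1)
    moreover have "B x \<in> V" using \<open>(x, B x) \<in> R\<close> R by blast
    ultimately obtain y where y: "y \<in> V" "is_exit \<rho> s B k y" "(B x, y) \<in> (below R \<rho> k)\<^sup>*"
      using Suc.IH by blast
    from \<open>(x, B x) \<in> below R \<rho> k\<close> y(3) have "(x, y) \<in> (below R \<rho> k)\<^sup>*"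
      by (rule converse_rtrancl_into_rtrancl)
    with y show ?thesis by blast
  qed
qed

text \<open>At every level the exits of the first tree have distinct components, while every component
  contains an exit of the second tree.\<close>

lemma card_exits_le:
  fixes \<rho> :: "'a \<Rightarrow> 'a \<Rightarrow> nat"
  assumes V: "finite V" "r \<in> V" "s \<in> V" and R: "R \<subseteq> V \<times> V" "sym R"
    and \<rho>: "\<And>x y. (x, y) \<in> R \<Longrightarrow> \<rho> x y = \<rho> y x"
    and T: "\<And>x y. x \<in> V \<Longrightarrow> y \<in> V \<Longrightarrow> is_exit \<rho> r T k x \<Longrightarrow> is_exit \<rho> r T k y \<Longrightarrow>
      (x, y) \<in> (below R \<rho> k)\<^sup>* \<Longrightarrow> x = y"
    and B: "\<And>x. x \<in> V \<Longrightarrow> x \<noteq> s \<Longrightarrow> (x, B x) \<in> R" "\<And>x. x \<in> V \<Longrightarrow> \<exists>n. (B ^^ n) x = s"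
  shows "card {x\<in>V - {r}. k \<le> \<rho> x (T x)} \<le> card {x\<in>V - {s}. k \<le> \<rho> x (B x)}"
proof -
  let ?LT = "{x\<in>V. is_exit \<rho> r T k x}" and ?LB = "{x\<in>V. is_exit \<rho> s B k x}"
  have symk: "(y, x) \<in> (below R \<rho> k)\<^sup>*" if "(x, y) \<in> (below R \<rho> k)\<^sup>*" for x y
    using that sym_rtrancl[OF sym_below[of R \<rho>, OF R(2) \<rho>]] by (auto dest: symD)
  have "\<forall>x\<in>V. \<exists>y\<in>?LB. (x, y) \<in> (below R \<rho> k)\<^sup>*"
  proof
    fix x assume x: "x \<in> V"
    then obtain n where "(B ^^ n) x = s" using B(2) by blast
    from exit_vertex_exists[where k = k and \<rho> = \<rho>, OF this x R(1) B(1)]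
    show "\<exists>y\<in>?LB. (x, y) \<in> (below R \<rho> k)\<^sup>*" by blast
  qed
  then obtain f where f: "\<And>x. x \<in> V \<Longrightarrow> f x \<in> ?LB" "\<And>x. x \<in> V \<Longrightarrow> (x, f x) \<in> (below R \<rho> k)\<^sup>*"
    by metis
  \<comment> \<open>Two exits of \<open>T\<close> with the same image are joined below level
    \<open>k\<close> through that image, so they coincide.\<close>
  have "inj_on f ?LT"
  proof (rule inj_onI)
    fix x y assume x: "x \<in> ?LT" and y: "y \<in> ?LT" and eq: "f x = f y"
    have "(f x, y) \<in> (below R \<rho> k)\<^sup>*" using symk f(2)[of y] y eq by simp
    then have "(x, y) \<in> (below R \<rho> k)\<^sup>*" using f(2)[of x] x by simp
    then show "x = y" using T x y by blast
  qed
  moreover have "f ` ?LT \<subseteq> ?LB" using f(1) by blast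
  ultimately have "card ?LT \<le> card ?LB" using V by (intro card_inj_on_le) auto
  \<comment> \<open>Each set of exits has exactly its root in addition to the vertices counted, so
    the roots cancel in the comparison.\<close>
  moreover have "?LT = insert r {x\<in>V - {r}. k \<le> \<rho> x (T x)}" "?LB = insert s {x\<in>V - {s}. k \<le> \<rho> x (B x)}"
    using V by (auto simp: is_exit_def)
  ultimately show ?thesis using V by simp
qed

section \<open>Pivot rule polytopes and neighbotopes\<close>

abbreviation edge_dir :: "('a::euclidean_space \<Rightarrow> real) \<Rightarrow> 'a \<Rightarrow> 'a \<Rightarrow> 'a" where
  "edge_dir \<eta> v u \<equiv> (u - v) /\<^sub>R \<eta> (u - v)"

lemma ED_subset: "ED \<eta> P \<subseteq> (\<lambda>(v, u). edge_dir \<eta> v u) ` (vertices P \<times> vertices P)"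
proof
  fix x assume "x \<in> ED \<eta> P"
  then obtain u v where uv: "u \<in> Nb P v" "x = edge_dir \<eta> v u" unfolding ED_def by blast
  then have "(v, u) \<in> vertices P \<times> vertices P" using Nb_vertices Nb_vertices' by blast
  then show "x \<in> (\<lambda>(v, u). edge_dir \<eta> v u) ` (vertices P \<times> vertices P)"
    unfolding uv(2) by (intro image_eqI[of _ _ "(v, u)"]) auto
qed

lemma finite_ED: "polytope P \<Longrightarrow> finite (ED \<eta> P)"
  by (rule finite_subset[OF ED_subset]) (simp add: finite_vertices)

lemma finite_ED_improving: "polytope P \<Longrightarrow> finite (ED_improving \<eta> P c)"
  by (rule finite_subset[OF _ finite_ED]) (auto simp: ED_def ED_improving_def)

text \<open>The maps are total and arbitrary off the vertices, but \<open>psi\<close> only sees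
  their restrictions, of which there are finitely many.\<close>

lemma finite_psi:
  assumes "polytope P"
  shows "finite {psi \<eta> P f |f. f \<in> vertices P \<rightarrow> vertices P}"
proof -
  let ?F = "vertices P \<rightarrow>\<^sub>E vertices P"
  have "{psi \<eta> P f |f. f \<in> vertices P \<rightarrow> vertices P} \<subseteq> psi \<eta> P ` ?F"
  proof clarify
    fix f assume f: "f \<in> vertices P \<rightarrow> vertices P"
    have "psi \<eta> P f = psi \<eta> P (restrict f (vertices P))"
      unfolding psi_def by (intro sum.cong) auto
    moreover have "restrict f (vertices P) \<in> ?F" using f by simp
    ultimately show "psi \<eta> P f \<in> psi \<eta> P ` ?F" by blast
  qed
  moreover have "finite ?F" using finite_vertices[OF assms] by (intro finite_PiE) auto
  ultimately show ?thesis by (meson finite_imageI finite_subset)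
qed

text \<open>Any selection of improving edges is a \<open>c\<close>-arborescence, so the choices at
  different vertices are independent and the vertexwise first directions combine to one selected
  point. This works for every order, hence \<open>G\<close> is the whole space.\<close>

lemma pivot_rule_polytope_summand:
  assumes P: "polytope P" "P \<noteq> {}" and c: "generic P c"
  shows "weak_Minkowski_summand (pivot_rule_polytope \<eta> P c) (SP (ED_improving \<eta> P c))"
  unfolding pivot_rule_polytope_def
proof (rule weak_Minkowski_summand_SP[where G = UNIV])
  show "finite (ED_improving \<eta> P c)" using P(1) by (rule finite_ED_improving)
  show "finite {psi \<eta> P A |A. c_arborescence P c A}"
    by (rule finite_subset[OF _ finite_psi[OF P(1)]]) (auto simp: c_arborescence_def)
  show "closure (UNIV :: 'a set) = UNIV" by simp
  fix w :: 'a and ps assume ps: "set ps = ED_improving \<eta> P c"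
  define D where "D v = {u \<in> Nb P v. c \<bullet> u > c \<bullet> v}" for v
  have "\<exists>u\<in>D v. \<forall>u'\<in>D v. edge_dir \<eta> v u' - edge_dir \<eta> v u \<in> order_cone ps"
    if "v \<in> vertices P" "v \<noteq> v_opt P c" for v
  proof (rule first_in_order)
    show "D v \<noteq> {}" using improving_neighbour_not_opt[OF P c that] by (auto simp: D_def)
    show "edge_dir \<eta> v ` D v \<subseteq> set ps" unfolding ps by (auto simp: D_def ED_improving_def)
  qed
  then obtain A where A: "\<And>v. v \<in> vertices P \<Longrightarrow> v \<noteq> v_opt P c \<Longrightarrow> A v \<in> D v"
    "\<And>v u. v \<in> vertices P \<Longrightarrow> v \<noteq> v_opt P c \<Longrightarrow> u \<in> D v \<Longrightarrow>
      edge_dir \<eta> v u - edge_dir \<eta> v (A v) \<in> order_cone ps" by metis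
  \<comment> \<open>The choice function is unspecified at the optimum, where a
    \<open>c\<close>-arborescence has to be fixed.\<close>
  define A' where "A' = A(v_opt P c := v_opt P c)"
  have carb: "c_arborescence P c A'"
    using A(1) v_opt_in[OF P c] Nb_subset unfolding c_arborescence_def A'_def D_def by fastforce
  have "psi \<eta> P B - psi \<eta> P A' \<in> order_cone ps" if B: "c_arborescence P c B" for B
    unfolding psi_def sum_subtractf[symmetric]
  proof (rule order_cone_sum)
    fix v assume v: "v \<in> vertices P"
    show "edge_dir \<eta> v (B v) - edge_dir \<eta> v (A' v) \<in> order_cone ps"
    proof (cases "v = v_opt P c")
      case True
      then show ?thesis using B by (simp add: A'_def c_arborescence_def zero_in_order_cone)
    next
      case False
      then have "B v \<in> D v" using B v by (simp add: c_arborescence_def D_def)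
      then show ?thesis using A(2)[OF v False] False by (simp add: A'_def)
    qed
  qed
  with carb show "\<exists>q0\<in>{psi \<eta> P A |A. c_arborescence P c A}.
      \<forall>q\<in>{psi \<eta> P A |A. c_arborescence P c A}. q - q0 \<in> order_cone ps"
    by blast
qed

section \<open>Neighbotopes for normalizations of constant sign\<close>

text \<open>The nongeneric objectives form a finite union of hyperplanes orthogonal to the edges,
  hence a null set with empty interior.\<close>

lemma dense_generic:
  assumes "polytope P"
  shows "closure {w. generic P w} = UNIV"
proof -
  let ?E = "{(v, u). u \<in> Nb P v}"
  have E: "- {w. generic P w} = (\<Union>e\<in>?E. {w. (snd e - fst e) \<bullet> w = 0})"
    by (auto simp: generic_def inner_commute[of "_ - _"] inner_diff_right)
  have "?E \<subseteq> vertices P \<times> vertices P" using Nb_vertices Nb_vertices' by blast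
  then have "finite ?E" using finite_vertices[OF assms] by (meson finite_SigmaI finite_subset)
  moreover have "negligible {w. (snd e - fst e) \<bullet> w = 0}" if "e \<in> ?E" for e
    using that Nb_neq[of "snd e" P "fst e"] by (intro negligible_hyperplane) auto
  ultimately have "negligible (- {w. generic P w})"
    unfolding E by (intro negligible_Union) auto
  then have "interior (- {w. generic P w}) = {}"
    using open_not_negligible interior_subset negligible_subset open_interior by metis
  then show ?thesis using closure_complement[of "- {w. generic P w}"] by simp
qed

lemma finite_arborescence_psi: "polytope P \<Longrightarrow> finite {psi \<eta> P B |B. arborescence P B}"
  by (rule finite_subset[OF _ finite_psi]) (auto simp: arborescence_def)

text \<open>The fixed point is unique because no vertex is its own neighbour.\<close>

lemma arborescenceI:
  assumes "r \<in> vertices P" "f r = r" "\<And>v. v \<in> vertices P \<Longrightarrow> v \<noteq> r \<Longrightarrow> f v \<in> Nb P v"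
    and "\<And>v. v \<in> vertices P \<Longrightarrow> \<exists>k\<ge>1. (f ^^ k) v = r"
  shows "arborescence P f"
proof -
  have "f \<in> vertices P \<rightarrow> vertices P" using assms(1-3) Nb_vertices by (metis Pi_I)
  moreover have "{v \<in> vertices P. f v = v} = {r}" using assms(1-3) Nb_neq by blast
  ultimately show ?thesis using assms(3,4) unfolding arborescence_def by blast
qed

lemma arborescenceE:
  assumes "arborescence P f"
  obtains r where "r \<in> vertices P" "f r = r" "\<And>v. v \<in> vertices P \<Longrightarrow> v \<noteq> r \<Longrightarrow> f v \<in> Nb P v"
    "\<And>v. v \<in> vertices P \<Longrightarrow> \<exists>k\<ge>1. (f ^^ k) v = r"
  using assms unfolding arborescence_def by blast

text \<open>With \<open>\<eta>\<close> of constant sign \<open>\<sigma>\<close>, the arborescence selected by \<open>w\<close> sends each vertex to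
  its first neighbour in the order. It is acyclic since it increases \<open>\<sigma> *\<^sub>R w\<close>.\<close>

lemma neighbotope_summand_constant_sign:
  assumes P: "polytope P" "P \<noteq> {}" and \<sigma>: "\<sigma> \<noteq> 0"
    and \<eta>: "\<And>v u. u \<in> Nb P v \<Longrightarrow> \<sigma> * \<eta> (u - v) > 0"
  shows "weak_Minkowski_summand (neighbotope \<eta> P) (SP (ED \<eta> P))"
  unfolding neighbotope_def
proof (rule weak_Minkowski_summand_SP[where G = "{w. generic P w}"])
  show "finite (ED \<eta> P)" using P(1) by (rule finite_ED)
  show "finite {psi \<eta> P B |B. arborescence P B}" using P(1) by (rule finite_arborescence_psi)
  show "closure {w. generic P w} = UNIV" using P(1) by (rule dense_generic)
  fix w and ps assume "w \<in> {w. generic P w}" and ps: "set ps = ED \<eta> P" and sorted: "sorted_by w ps"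
  \<comment> \<open>The sign of \<open>\<eta>\<close> is absorbed here: \<open>w\<close> is positive
    on the direction from \<open>v\<close> to \<open>u\<close> exactly if \<open>w'\<close>
    increases from \<open>v\<close> to \<open>u\<close>.\<close>
  define w' where "w' = \<sigma> *\<^sub>R w"
  have w': "generic P w'" using \<open>w \<in> _\<close> \<sigma> by (simp add: w'_def generic_def)
  have dir_in: "edge_dir \<eta> v u \<in> set ps" if "u \<in> Nb P v" for u v
    unfolding ps ED_def using that by blast
  have sign: "w \<bullet> edge_dir \<eta> v u > 0 \<longleftrightarrow> w' \<bullet> u > w' \<bullet> v" "w \<bullet> edge_dir \<eta> v u < 0 \<longleftrightarrow> w' \<bullet> u < w' \<bullet> v"
    if "u \<in> Nb P v" for u v
  proof -
    have "\<eta> (u - v) \<noteq> 0" using \<eta>[OF that] by auto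
    then have "(w \<bullet> edge_dir \<eta> v u) * (\<sigma> * \<eta> (u - v)) = \<sigma> * (w \<bullet> (u - v))"
      by simp
    then have eq: "(w \<bullet> edge_dir \<eta> v u) * (\<sigma> * \<eta> (u - v)) = w' \<bullet> u - w' \<bullet> v"
      by (simp add: w'_def inner_diff_right right_diff_distrib)
    show "w \<bullet> edge_dir \<eta> v u > 0 \<longleftrightarrow> w' \<bullet> u > w' \<bullet> v"
      using zero_less_mult_iff[of "w \<bullet> edge_dir \<eta> v u" "\<sigma> * \<eta> (u - v)"] \<eta>[OF that] eq by auto
    show "w \<bullet> edge_dir \<eta> v u < 0 \<longleftrightarrow> w' \<bullet> u < w' \<bullet> v"
      using mult_less_0_iff[of "w \<bullet> edge_dir \<eta> v u" "\<sigma> * \<eta> (u - v)"] \<eta>[OF that] eq by auto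
  qed
  \<comment> \<open>\<open>\<eta>\<close> has the same sign on both orientations of an edge, so
    their directions are negative multiples of each other.\<close>
  have opposite: "\<exists>k>0. edge_dir \<eta> u v = - (k *\<^sub>R edge_dir \<eta> v u)" if "u \<in> Nb P v" for u v
  proof (intro exI conjI)
    have pos: "\<sigma> * \<eta> (u - v) > 0" "\<sigma> * \<eta> (v - u) > 0"
      using \<eta>[OF that] \<eta>[of v u] that Nb_commute by blast+
    then have "0 < (\<sigma> * \<eta> (u - v)) / (\<sigma> * \<eta> (v - u))" by (rule divide_pos_pos)
    then show "0 < \<eta> (u - v) / \<eta> (v - u)" using \<sigma> by simp
    have "\<eta> (u - v) \<noteq> 0" using pos by auto
    then show "edge_dir \<eta> u v = - ((\<eta> (u - v) / \<eta> (v - u)) *\<^sub>R edge_dir \<eta> v u)"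
      by (simp add: divide_inverse flip: scaleR_minus_right)
  qed
  have inner_opposite: "w \<bullet> (- (k *\<^sub>R x)) = - (k * (w \<bullet> x))" for k and x :: 'a by simp
  \<comment> \<open>If \<open>w\<close> is negative on a direction \<open>d\<close>, it is positive
    on the opposite direction \<open>- k d\<close>. Their difference \<open>(1 + k) d\<close> lies
    in the order cone and is rescaled.\<close>
  have neg: "edge_dir \<eta> v u \<in> order_cone ps" if uv: "u \<in> Nb P v" "w \<bullet> edge_dir \<eta> v u < 0" for u v
  proof -
    obtain k where k: "k > 0" "edge_dir \<eta> u v = - (k *\<^sub>R edge_dir \<eta> v u)"
      using opposite[OF uv(1)] by blast
    have "w \<bullet> edge_dir \<eta> u v > 0" unfolding k(2) inner_opposite
      using mult_pos_neg[OF k(1) uv(2)] by linarith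
    then have "edge_dir \<eta> v u - edge_dir \<eta> u v \<in> order_cone ps"
      using uv Nb_commute by (intro order_cone_diff_less[OF sorted] dir_in) auto
    also have "edge_dir \<eta> v u - edge_dir \<eta> u v = (1 + k) *\<^sub>R edge_dir \<eta> v u"
      unfolding k(2) by (simp only: scaleR_left_distrib) simp
    finally have "(1 / (1 + k)) *\<^sub>R ((1 + k) *\<^sub>R edge_dir \<eta> v u) \<in> order_cone ps"
      by (rule order_cone_scaleR) (use k(1) in simp)
    then show ?thesis using k(1) by simp
  qed
  have pos: "- edge_dir \<eta> v u \<in> order_cone ps" if uv: "u \<in> Nb P v" "w \<bullet> edge_dir \<eta> v u > 0" for u v
  proof -
    obtain k where k: "k > 0" "edge_dir \<eta> u v = - (k *\<^sub>R edge_dir \<eta> v u)"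
      using opposite[OF uv(1)] by blast
    have "w \<bullet> edge_dir \<eta> u v < 0" unfolding k(2) inner_opposite
      using mult_pos_pos[OF k(1) uv(2)] by linarith
    then have "edge_dir \<eta> u v \<in> order_cone ps" using uv Nb_commute by (intro neg) auto
    then have "(1 / k) *\<^sub>R edge_dir \<eta> u v \<in> order_cone ps"
      by (rule order_cone_scaleR) (use k(1) in simp)
    then show ?thesis unfolding k(2) using k(1) by simp
  qed
  let ?o = "v_opt P w'"
  have "\<exists>u\<in>Nb P v. \<forall>u'\<in>Nb P v. edge_dir \<eta> v u' - edge_dir \<eta> v u \<in> order_cone ps"
    if "v \<in> vertices P" "v \<noteq> ?o" for v
  proof (rule first_in_order)
    show "Nb P v \<noteq> {}" using improving_neighbour_not_opt[OF P w' that] by blast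
    show "edge_dir \<eta> v ` Nb P v \<subseteq> set ps" using dir_in by blast
  qed
  then obtain f where f: "\<And>v. v \<in> vertices P \<Longrightarrow> v \<noteq> ?o \<Longrightarrow> f v \<in> Nb P v"
    "\<And>v u. v \<in> vertices P \<Longrightarrow> v \<noteq> ?o \<Longrightarrow> u \<in> Nb P v \<Longrightarrow>
      edge_dir \<eta> v u - edge_dir \<eta> v (f v) \<in> order_cone ps" by metis
  define B where "B = f(?o := ?o)"
  have B: "B ?o = ?o" "\<And>v. v \<in> vertices P \<Longrightarrow> v \<noteq> ?o \<Longrightarrow> B v \<in> Nb P v"
    "\<And>v u. v \<in> vertices P \<Longrightarrow> v \<noteq> ?o \<Longrightarrow> u \<in> Nb P v \<Longrightarrow>
      edge_dir \<eta> v u - edge_dir \<eta> v (B v) \<in> order_cone ps"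
    using f by (auto simp: B_def)
  \<comment> \<open>Some improving edge has a positive value, and the direction chosen first has at
    least this value.\<close>
  have Bpos: "w \<bullet> edge_dir \<eta> v (B v) > 0" if v: "v \<in> vertices P" "v \<noteq> ?o" for v
  proof -
    obtain u where u: "u \<in> Nb P v" "w' \<bullet> u > w' \<bullet> v"
      using improving_neighbour_not_opt[OF P w' v] by blast
    have "w \<bullet> edge_dir \<eta> v u - w \<bullet> edge_dir \<eta> v (B v) \<le> 0"
      using order_cone_inner_le[OF sorted B(3)[OF v u(1)]] by (simp only: inner_diff_right)
    moreover have "w \<bullet> edge_dir \<eta> v u > 0" using sign(1)[OF u(1)] u(2) by simp
    ultimately show ?thesis by linarith
  qed
  have Binc: "B v \<in> Nb P v \<and> w' \<bullet> B v > w' \<bullet> v" if "v \<in> vertices P" "v \<noteq> ?o" for v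
    using B(2)[OF that] Bpos[OF that] sign(1)[OF B(2)[OF that]] by blast
  have arb: "arborescence P B"
    using v_opt_in[OF P w'] B(1,2) improving_path_to_opt[OF P w' _ Binc B(1)]
    by (intro arborescenceI[of ?o]) blast+
  have "psi \<eta> P B' - psi \<eta> P B \<in> order_cone ps" if B': "arborescence P B'" for B'
    unfolding psi_def sum_subtractf[symmetric]
  proof (rule order_cone_sum)
    fix v assume v: "v \<in> vertices P"
    \<comment> \<open>The roots of \<open>B'\<close> and \<open>B\<close> may differ. At the optimum
      \<open>B'\<close> contributes 0 or a negative direction, handled by \<open>neg\<close>; at a
      root of \<open>B'\<close> elsewhere the difference is the negative of a positive direction,
      handled by \<open>pos\<close>; at all other vertices \<open>B\<close> was chosen
      first.\<close>
    have B'v: "B' v = v \<or> B' v \<in> Nb P v" using B' v by (elim arborescenceE) metis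
    show "edge_dir \<eta> v (B' v) - edge_dir \<eta> v (B v) \<in> order_cone ps"
    proof (cases "v = ?o")
      case True
      have "edge_dir \<eta> v (B' v) \<in> order_cone ps" if "B' v \<in> Nb P v"
      proof (rule neg[OF that])
        have "w' \<bullet> B' v \<le> w' \<bullet> v" unfolding True
          using v_opt_max[OF P w'] Nb_vertices[OF that] True by blast
        then show "w \<bullet> edge_dir \<eta> v (B' v) < 0"
          using w' that sign(2)[OF that] unfolding generic_def by (metis order_le_less)
      qed
      then show ?thesis using B'v True B(1) zero_in_order_cone by auto
    next
      case False
      show ?thesis
      proof (cases "B' v = v")
        case True
        then show ?thesis using pos[OF B(2)[OF v False] Bpos[OF v False]] by simp
      next
        case False
        then show ?thesis using B'v B(3)[OF v \<open>v \<noteq> ?o\<close>] by blast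
      qed
    qed
  qed
  with arb show "\<exists>q0\<in>{psi \<eta> P B |B. arborescence P B}.
      \<forall>q\<in>{psi \<eta> P B |B. arborescence P B}. q - q0 \<in> order_cone ps"
    by blast
qed

section \<open>Neighbotopes for odd normalizations\<close>

text \<open>For a generic objective both vertices reach the optimum along improving edges; one of
  the two paths is then reversed.\<close>

lemma vertex_graph_connected:
  assumes P: "polytope P" "P \<noteq> {}" and v: "v \<in> vertices P" and r: "r \<in> vertices P"
  shows "(r, v) \<in> {(x, y). y \<in> Nb P x}\<^sup>*"
proof -
  let ?R = "{(x, y). y \<in> Nb P x}"
  have "{w. generic P w} \<noteq> {}" using dense_generic[OF P(1)] by force
  then obtain c where c: "generic P c" by blast
  have "\<forall>v\<in>vertices P - {v_opt P c}. \<exists>u. u \<in> Nb P v \<and> c \<bullet> u > c \<bullet> v"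
    using improving_neighbour_not_opt[OF P c] by blast
  then obtain f where f: "\<And>v. v \<in> vertices P \<Longrightarrow> v \<noteq> v_opt P c \<Longrightarrow> f v \<in> Nb P v \<and> c \<bullet> f v > c \<bullet> v"
    by (metis DiffI singletonD)
  define g where "g = f(v_opt P c := v_opt P c)"
  have g: "g v \<in> Nb P v \<and> c \<bullet> g v > c \<bullet> v" if "v \<in> vertices P" "v \<noteq> v_opt P c" for v
    using f[OF that] that by (simp add: g_def)
  have gopt: "g (v_opt P c) = v_opt P c" by (simp add: g_def)
  have step: "x \<in> vertices P \<Longrightarrow> (x, (g ^^ n) x) \<in> ?R\<^sup>* \<and> (g ^^ n) x \<in> vertices P" for x n
  proof (induction n)
    case (Suc n)
    let ?y = "(g ^^ n) x"
    have "(?y, g ?y) \<in> ?R\<^sup>* \<and> g ?y \<in> vertices P"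
      using Suc gopt g[of ?y] Nb_vertices by (cases "?y = v_opt P c") auto
    then show ?case using Suc by (auto intro: rtrancl_trans)
  qed simp
  have opt: "(x, v_opt P c) \<in> ?R\<^sup>*" if x: "x \<in> vertices P" for x
    using improving_path_to_opt[OF P c x g gopt] step[OF x] by metis
  have "sym ?R" using Nb_commute by (auto simp: sym_def)
  then have "(v_opt P c, v) \<in> ?R\<^sup>*" using opt[OF v] sym_rtrancl by (metis symD)
  then show ?thesis using opt[OF r] by (rule rtrancl_trans[rotated])
qed

text \<open>With \<open>\<eta>\<close> odd, both orientations of an edge have the same direction, and an arborescence is
  an oriented spanning tree. The one selected by an order is the minimum spanning tree.\<close>

lemma neighbotope_summand_odd:
  assumes P: "polytope P" "P \<noteq> {}"
    and odd: "\<And>v u. u \<in> Nb P v \<Longrightarrow> \<eta> (v - u) = - \<eta> (u - v)"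
  shows "weak_Minkowski_summand (neighbotope \<eta> P) (SP (ED \<eta> P))"
  unfolding neighbotope_def
proof (rule weak_Minkowski_summand_SP[where G = UNIV])
  show "finite (ED \<eta> P)" using P(1) by (rule finite_ED)
  show "finite {psi \<eta> P B |B. arborescence P B}" using P(1) by (rule finite_arborescence_psi)
  show "closure (UNIV :: 'a set) = UNIV" by simp
  fix w :: 'a and ps assume ps: "set ps = ED \<eta> P"
  let ?V = "vertices P" and ?R = "{(x, y). y \<in> Nb P x}"
  have finV: "finite ?V" using P(1) by (rule finite_vertices)
  obtain r where r: "r \<in> ?V" using vertices_nonempty[OF P] by blast
  \<comment> \<open>The rank depends on the edge only through its direction, so edges with equal
    directions share a rank.\<close>
  define \<rho> where "\<rho> v u = (LEAST i. i < length ps \<and> ps ! i = edge_dir \<eta> v u)" for v u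
  have \<rho>: "\<rho> v u < length ps \<and> ps ! \<rho> v u = edge_dir \<eta> v u" if "u \<in> Nb P v" for v u
  proof -
    have "edge_dir \<eta> v u \<in> set ps" unfolding ps ED_def using that by blast
    then have "\<exists>i. i < length ps \<and> ps ! i = edge_dir \<eta> v u" by (auto simp: in_set_conv_nth)
    then show ?thesis unfolding \<rho>_def by (rule LeastI_ex)
  qed
  have sym\<rho>: "\<rho> x y = \<rho> y x" if "(x, y) \<in> ?R" for x y
  proof -
    have "edge_dir \<eta> y x = edge_dir \<eta> x y"
      using odd[of y x] that by (simp flip: scaleR_minus_right)
    then show ?thesis unfolding \<rho>_def by simp
  qed
  have RV: "?R \<subseteq> ?V \<times> ?V" using Nb_vertices Nb_vertices' by blast
  have symR: "sym ?R" using Nb_commute by (auto simp: sym_def)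
  obtain T where T: "T r = r" "\<And>x. x \<in> ?V \<Longrightarrow> x \<noteq> r \<Longrightarrow> (x, T x) \<in> ?R"
    "\<And>x. x \<in> ?V \<Longrightarrow> \<exists>k\<ge>1. (T ^^ k) x = r"
    "\<And>k x y. x \<in> ?V \<Longrightarrow> y \<in> ?V \<Longrightarrow> is_exit \<rho> r T k x \<Longrightarrow> is_exit \<rho> r T k y \<Longrightarrow>
      (x, y) \<in> (below ?R \<rho> k)\<^sup>* \<Longrightarrow> x = y"
    using prim_tree_exists[of ?V r ?R \<rho>, OF finV r RV symR sym\<rho> vertex_graph_connected[OF P _ r]]
    by blast
  have arb: "arborescence P T" using r T by (intro arborescenceI[of r]) auto
  have psi: "psi \<eta> P B = (\<Sum>v\<in>?V - {s}. ps ! \<rho> v (B v))"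
    if "s \<in> ?V" "B s = s" "\<And>v. v \<in> ?V \<Longrightarrow> v \<noteq> s \<Longrightarrow> B v \<in> Nb P v" for B s
  proof -
    have "psi \<eta> P B = (\<Sum>v\<in>?V - {s}. edge_dir \<eta> v (B v))"
      unfolding psi_def by (subst sum.remove[OF finV that(1)]) (simp add: that(2))
    also have "\<dots> = (\<Sum>v\<in>?V - {s}. ps ! \<rho> v (B v))"
      using \<rho> that(3) by (intro sum.cong) auto
    finally show ?thesis .
  qed
  have "psi \<eta> P B - psi \<eta> P T \<in> order_cone ps" if "arborescence P B" for B
    using that
  proof (rule arborescenceE)
    fix s assume s: "s \<in> ?V" "B s = s" and Bnb: "\<And>v. v \<in> ?V \<Longrightarrow> v \<noteq> s \<Longrightarrow> B v \<in> Nb P v"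
      and Bpath: "\<And>v. v \<in> ?V \<Longrightarrow> \<exists>k\<ge>1. (B ^^ k) v = s"
    \<comment> \<open>The roots \<open>r\<close> and \<open>s\<close> may differ: each count leaves
      out its own root, and both trees have one edge less than there are vertices.\<close>
    have "card {x\<in>?V - {r}. k \<le> \<rho> x (T x)} \<le> card {x\<in>?V - {s}. k \<le> \<rho> x (B x)}" for k
    proof (rule card_exits_le[where R = ?R])
      show "\<And>x. x \<in> ?V \<Longrightarrow> x \<noteq> s \<Longrightarrow> (x, B x) \<in> ?R" using Bnb by simp
      show "\<And>x. x \<in> ?V \<Longrightarrow> \<exists>n. (B ^^ n) x = s" using Bpath by blast
    qed (fact finV r s RV symR sym\<rho> T(4))+
    moreover have "card (?V - {s}) = card (?V - {r})" using finV r s by simp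
    moreover have "psi \<eta> P B = (\<Sum>v\<in>?V - {s}. ps ! \<rho> v (B v))" using s Bnb by (rule psi)
    moreover have "psi \<eta> P T = (\<Sum>v\<in>?V - {r}. ps ! \<rho> v (T v))" using r T(1,2) by (intro psi) auto
    ultimately show ?thesis
      using finV \<rho> Bnb T(2) by (simp only:) (intro order_cone_sum_diff; simp)
  qed
  with arb show "\<exists>q0\<in>{psi \<eta> P B |B. arborescence P B}.
      \<forall>q\<in>{psi \<eta> P B |B. arborescence P B}. q - q0 \<in> order_cone ps"
    by blast
qed

text \<open>For the neighbotope the sign pattern of \<open>\<eta>\<close> enters as a premise, since
  with mixed signs the claim fails for the triangle described at \<open>neighbotope\<close>.\<close>

theorem theorem1p7:
  fixes P :: "'a::euclidean_space set" and c :: 'a and \<eta> :: "'a \<Rightarrow> real"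
  assumes "polytope P" and "P \<noteq> {}"
    and "generic P c"
    and "normalization P \<eta>"
  shows "weak_Minkowski_summand (pivot_rule_polytope \<eta> P c) (SP (ED_improving \<eta> P c)) \<and>
    (((\<forall>v u. u \<in> Nb P v \<longrightarrow> \<eta> (u - v) > 0) \<or>
      (\<forall>v u. u \<in> Nb P v \<longrightarrow> \<eta> (u - v) < 0) \<or>
      (\<forall>v u. u \<in> Nb P v \<longrightarrow> \<eta> (v - u) = - \<eta> (u - v)))
     \<longrightarrow> weak_Minkowski_summand (neighbotope \<eta> P) (SP (ED \<eta> P)))"
proof (intro conjI impI)
  show "weak_Minkowski_summand (pivot_rule_polytope \<eta> P c) (SP (ED_improving \<eta> P c))"
    using assms(1-3) by (rule pivot_rule_polytope_summand)
next
  assume "(\<forall>v u. u \<in> Nb P v \<longrightarrow> \<eta> (u - v) > 0) \<or>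
    (\<forall>v u. u \<in> Nb P v \<longrightarrow> \<eta> (u - v) < 0) \<or>
    (\<forall>v u. u \<in> Nb P v \<longrightarrow> \<eta> (v - u) = - \<eta> (u - v))"
  then show "weak_Minkowski_summand (neighbotope \<eta> P) (SP (ED \<eta> P))"
  proof (elim disjE)
    assume "\<forall>v u. u \<in> Nb P v \<longrightarrow> \<eta> (u - v) > 0"
    then show ?thesis using assms by (intro neighbotope_summand_constant_sign[of P 1]) auto
  next
    assume "\<forall>v u. u \<in> Nb P v \<longrightarrow> \<eta> (u - v) < 0"
    then show ?thesis using assms by (intro neighbotope_summand_constant_sign[of P "- 1"]) auto
  next
    assume "\<forall>v u. u \<in> Nb P v \<longrightarrow> \<eta> (v - u) = - \<eta> (u - v)"
    then show ?thesis using assms by (intro neighbotope_summand_odd) auto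
  qed
qed

end
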